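(* Let $1\le i\le k<n$ and let $\alpha_{i,n}$ be an arbitrary positive real number. The cdf $H$ of $\sigma^{-1}\alpha_{i,n}(\tilde\theta_{AS,i}-\theta_i)$ under $P_{n,\theta,\sigma}$ is given by $$H(x)=\int_0^\infty\Phi\left(z_{n,\theta,\sigma}^{(2)}(x,s\eta_{i,n})\right)\rho_{n-k}(s)\,ds\,\mathbf{1}\left(\alpha_{i,n}^{-1}x+\theta_i/\sigma\ge0\right)+\int_0^\infty\Phi\left(z_{n,\theta,\sigma}^{(1)}(x,s\eta_{i,n})\right)\rho_{n-k}(s)\,ds\,\mathbf{1}\left(\alpha_{i,n}^{-1}x+\theta_i/\sigma<0\right).$$ Or, equivalently, the corresponding measure is $$dH(x)=\int_0^\infty\left\{\Phi\left(n^{1/2}(-\theta_i/(\sigma\xi_{i,n})+s\eta_{i,n})\right)-\Phi\left(n^{1/2}(-\theta_i/(\sigma\xi_{i,n})-s\eta_{i,n})\right)\right\}\rho_{n-k}(s)\,ds\;d\delta_{-\alpha_{i,n}\theta_i/\sigma}(x)$$ $$+\left(0.5n^{1/2}/(\alpha_{i,n}\xi_{i,n})\right)\Big\{\int_0^\infty\phi\left(z_{n,\theta,\sigma}^{(2)}(x,s\eta_{i,n})\right)(1+t_{n,\theta,\sigma}(x,s\eta_{i,n}))\rho_{n-k}(s)\,ds\,\mathbf{1}\left(\alpha_{i,n}^{-1}x+\theta_i/\sigma>0\right)$$ $$\qquad+\int_0^\infty\phi\left(z_{n,\theta,\sigma}^{(1)}(x,s\eta_{i,n})\right)(1-t_{n,\theta,\sigma}(x,s\eta_{i,n}))\rho_{n-k}(s)\,ds\,\mathbf{1}\left(\alpha_{i,n}^{-1}x+\theta_i/\sigma<0\right)\Big\}dx,$$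 where $\delta_z$ denotes pointmass at $z$.
   Context: Consider the linear regression model $Y=X\theta+u$, where $X$ is a nonstochastic $n\times k$ matrix of rank $k\ge1$ with $n>k$, $\theta\in\mathbb{R}^k$, $u\sim N(0,\sigma^2I_n)$, $0<\sigma<\infty$; $P_{n,\theta,\sigma}$ denotes probability under parameters $\theta,\sigma$. $X'$ is the transpose of $X$. $\xi_{i,n}$ is the nonnegative square root of the $i$-th diagonal element of $(X'X/n)^{-1}$. $\hat\theta_{LS}=(X'X)^{-1}X'Y$ with $i$-th component $\hat\theta_{LS,i}$, and $\hat\sigma^2=(n-k)^{-1}(Y-X\hat\theta_{LS})'(Y-X\hat\theta_{LS})$, $\hat\sigma\ge0$. The tuning parameter $\eta_{i,n}$ is a positive real number. The adaptive soft-thresholding estimator is $\tilde\theta_{AS,i}=\hat\theta_{LS,i}(1-\hat\sigma^2\xi_{i,n}^2\eta_{i,n}^2/\hat\theta_{LS,i}^2)_+$, i.e. $0$ if $|\hat\theta_{LS,i}|\le\hat\sigma\xi_{i,n}\eta_{i,n}$ and $\hat\theta_{LS,i}-\hat\sigma^2\xi_{i,n}^2\eta_{i,n}^2/\hat\theta_{LS,i}$ otherwise. $\Phi,\phi$ are the standard normal cdf and pdf. $\rho_m$ is the density of $m^{-1/2}$ times the square root of a chi-square random variable with $m$ degrees of freedom. The quantities $z_{n,\theta,\sigma}^{(1)}(x,y)\le z_{n,\theta,\sigma}^{(2)}(x,y)$ are defined by $$0.5n^{1/2}\xi_{i,n}^{-1}(\alpha_{i,n}^{-1}x-\theta_i/\sigma)\pm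 n^{1/2}\sqrt{\left(0.5\xi_{i,n}^{-1}(\alpha_{i,n}^{-1}x+\theta_i/\sigma)\right)^2+y^2}$$ (minus sign for $z^{(1)}$, plus sign for $z^{(2)}$), and $$t_{n,\theta,\sigma}(x,y)=0.5\xi_{i,n}^{-1}(\alpha_{i,n}^{-1}x+\theta_i/\sigma)\big/\left((0.5\xi_{i,n}^{-1}(\alpha_{i,n}^{-1}x+\theta_i/\sigma))^2+y^2\right)^{1/2}.$$ *)

theory Defs
  imports "HOL-Probability.Probability"
begin

definition ls_estimator :: "real^'k^'n \<Rightarrow> real^'n \<Rightarrow> real^'k" where
  "ls_estimator X y = matrix_inv (transpose X ** X) *v (transpose X *v y)"

definition sigma_hat :: "real^'k^'n \<Rightarrow> real^'n \<Rightarrow> real" where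
  "sigma_hat X y =
     (let r = y - X *v ls_estimator X y
      in sqrt ((r \<bullet> r) / (real CARD('n) - real CARD('k))))"

definition xi :: "real^'k^'n \<Rightarrow> 'k \<Rightarrow> real" where
  "xi X i = sqrt (matrix_inv ((1 / real CARD('n)) *\<^sub>R (transpose X ** X)) $ i $ i)"

definition adaptive_soft :: "real^'k^'n \<Rightarrow> real \<Rightarrow> 'k \<Rightarrow> real^'n \<Rightarrow> real" where
  "adaptive_soft X \<eta> i y =
     (let b = ls_estimator X y $ i
      in b * max 0 (1 - (sigma_hat X y)\<^sup>2 * (xi X i)\<^sup>2 * \<eta>\<^sup>2 / b\<^sup>2))"

text \<open>The convention \<open>x / 0 = 0\<close> does no harm at \<open>b = 0\<close>, because of the factor \<open>b\<close>; the
  next lemma makes this explicit.\<close>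

lemma adaptive_soft_cases:
  fixes X :: "real^'k^'n"
  assumes "c = sigma_hat X y * xi X i * \<eta>" and "c \<ge> 0" and "b = ls_estimator X y $ i"
  shows "adaptive_soft X \<eta> i y = (if \<bar>b\<bar> \<le> c then 0 else b - c\<^sup>2 / b)"
proof -
  have eq: "adaptive_soft X \<eta> i y = b * max 0 (1 - c\<^sup>2 / b\<^sup>2)"
    by (simp add: adaptive_soft_def Let_def assms(1,3) power_mult_distrib)
  show ?thesis
  proof (cases "\<bar>b\<bar> \<le> c")
    case True
    then have "b\<^sup>2 \<le> c\<^sup>2"
      by (metis abs_le_square_iff abs_of_nonneg assms(2))
    then show ?thesis
      using True by (cases "b = 0") (auto simp: eq max_def field_simps)
  next
    case False
    then have b: "b \<noteq> 0" and "c\<^sup>2 \<le> b\<^sup>2"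
      using assms(2) by (auto simp: abs_le_square_iff[symmetric])
    then have "max 0 (1 - c\<^sup>2 / b\<^sup>2) = 1 - c\<^sup>2 / b\<^sup>2"
      by (simp add: max_def field_simps)
    then show ?thesis
      using False b by (simp add: eq right_diff_distrib power2_eq_square)
  qed
qed

abbreviation std_normal_cdf :: "real \<Rightarrow> real" where
  "std_normal_cdf \<equiv> cdf std_normal_distribution"

definition chi_square :: "nat \<Rightarrow> real measure" where
  "chi_square m =
     distr (PiM {..<m} (\<lambda>_. std_normal_distribution)) borel (\<lambda>z. \<Sum>j<m. (z j)\<^sup>2)"

text \<open>A Lebesgue density is determined only almost everywhere; it is used under integrals only.
  For \<open>m \<ge> 1\<close> the law below is absolutely continuous, so that its Radon-Nikodym
  derivative is a density of it.\<close>

definition rho :: "nat \<Rightarrow> real \<Rightarrow> real" where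
  "rho m s = enn2real
     (RN_deriv lborel (distr (chi_square m) borel (\<lambda>c. sqrt c / sqrt (real m))) s)"

text \<open>In the following functions \<open>n\<close> is the sample size, \<open>\<xi>\<close>, \<open>\<alpha>\<close> and \<open>b\<close> stand for
  \<open>\<xi>\<^sub>i\<close>, \<open>\<alpha>\<^sub>i\<close> and the \<open>i\<close>-th component of the regression parameter.\<close>

definition z1 :: "nat \<Rightarrow> real \<Rightarrow> real \<Rightarrow> real \<Rightarrow> real \<Rightarrow> real \<Rightarrow> real \<Rightarrow> real" where
  "z1 n \<xi> \<alpha> b \<sigma> x y =
     1/2 * sqrt (real n) * inverse \<xi> * (x / \<alpha> - b / \<sigma>)
     - sqrt (real n) * sqrt ((1/2 * inverse \<xi> * (x / \<alpha> + b / \<sigma>))\<^sup>2 + y\<^sup>2)"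

definition z2 :: "nat \<Rightarrow> real \<Rightarrow> real \<Rightarrow> real \<Rightarrow> real \<Rightarrow> real \<Rightarrow> real \<Rightarrow> real" where
  "z2 n \<xi> \<alpha> b \<sigma> x y =
     1/2 * sqrt (real n) * inverse \<xi> * (x / \<alpha> - b / \<sigma>)
     + sqrt (real n) * sqrt ((1/2 * inverse \<xi> * (x / \<alpha> + b / \<sigma>))\<^sup>2 + y\<^sup>2)"

definition t_fun :: "real \<Rightarrow> real \<Rightarrow> real \<Rightarrow> real \<Rightarrow> real \<Rightarrow> real \<Rightarrow> real" where
  "t_fun \<xi> \<alpha> b \<sigma> x y =
     (1/2 * inverse \<xi> * (x / \<alpha> + b / \<sigma>))
     / sqrt ((1/2 * inverse \<xi> * (x / \<alpha> + b / \<sigma>))\<^sup>2 + y\<^sup>2)"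

definition H_cdf :: "nat \<Rightarrow> nat \<Rightarrow> real \<Rightarrow> real \<Rightarrow> real \<Rightarrow> real \<Rightarrow> real \<Rightarrow> real \<Rightarrow> real" where
  "H_cdf n k \<xi> \<alpha> \<eta> b \<sigma> x =
     (LBINT s:{0<..}. std_normal_cdf (z2 n \<xi> \<alpha> b \<sigma> x (s * \<eta>)) * rho (n - k) s)
       * of_bool (x / \<alpha> + b / \<sigma> \<ge> 0)
     + (LBINT s:{0<..}. std_normal_cdf (z1 n \<xi> \<alpha> b \<sigma> x (s * \<eta>)) * rho (n - k) s)
       * of_bool (x / \<alpha> + b / \<sigma> < 0)"

definition H_atom :: "nat \<Rightarrow> nat \<Rightarrow> real \<Rightarrow> real \<Rightarrow> real \<Rightarrow> real \<Rightarrow> real" where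
  "H_atom n k \<xi> \<eta> b \<sigma> =
     (LBINT s:{0<..}.
        (std_normal_cdf (sqrt (real n) * (- b / (\<sigma> * \<xi>) + s * \<eta>))
         - std_normal_cdf (sqrt (real n) * (- b / (\<sigma> * \<xi>) - s * \<eta>))) * rho (n - k) s)"

definition H_density :: "nat \<Rightarrow> nat \<Rightarrow> real \<Rightarrow> real \<Rightarrow> real \<Rightarrow> real \<Rightarrow> real \<Rightarrow> real \<Rightarrow> real" where
  "H_density n k \<xi> \<alpha> \<eta> b \<sigma> x =
     (1/2 * sqrt (real n) / (\<alpha> * \<xi>)) *
     ((LBINT s:{0<..}. std_normal_density (z2 n \<xi> \<alpha> b \<sigma> x (s * \<eta>))
          * (1 + t_fun \<xi> \<alpha> b \<sigma> x (s * \<eta>)) * rho (n - k) s)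
        * of_bool (x / \<alpha> + b / \<sigma> > 0)
      + (LBINT s:{0<..}. std_normal_density (z1 n \<xi> \<alpha> b \<sigma> x (s * \<eta>))
          * (1 - t_fun \<xi> \<alpha> b \<sigma> x (s * \<eta>)) * rho (n - k) s)
        * of_bool (x / \<alpha> + b / \<sigma> < 0))"

end

theory Submission
  imports Defs
begin

text \<open>Write \<open>\<sigma> Z\<close> for the noise, so that \<open>Z\<close> is a standard Gaussian vector. The error
  \<open>\<theta>\<^sub>L\<^sub>S\<^sub>,\<^sub>i - \<theta>\<^sub>i\<close> is \<open>c \<bullet> (\<sigma> Z)\<close> for a vector \<open>c\<close> in the column space of \<open>X\<close> with
  \<open>\<xi>\<^sub>i = sqrt n * norm c\<close>, whereas the residual sum of squares is the sum of \<open>(b \<bullet> (\<sigma> Z))\<^sup>2\<close>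
  over an orthonormal basis \<open>B\<close> of the orthogonal complement of that space
  (\<open>regression_geometry\<close>). After a rotation, which does not change the law of \<open>Z\<close>, the
  vectors \<open>c / norm c\<close> and \<open>b \<in> B\<close> are coordinate vectors. Therefore the standardised
  estimation error \<open>W\<close> is standard normal and independent of \<open>S = \<sigma>_hat / \<sigma>\<close>, which is
  distributed as the square root of a chi-square variable divided by its \<open>n - k\<close> degrees of
  freedom (\<open>joint_law_std_gaussian\<close>). That law is absolutely continuous, so \<open>rho (n - k)\<close>
  really is a density of it (\<open>scaled_chi_eq_density_rho\<close>).

  Thresholding commutes with scaling by \<open>\<sigma>\<close>, so the scaled error of the estimator is a function
  \<open>err (S \<eta>) W\<close>. For a fixed threshold the map \<open>err y\<close> is monotone, and solving the
  quadratic equation behind it gives \<open>err y w \<le> x\<close> exactly if \<open>w\<close> is at most \<open>z\<^sup>(\<^sup>2\<^sup>)\<close> or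
  \<open>z\<^sup>(\<^sup>1\<^sup>)\<close>, depending on the side of the atom \<open>- \<alpha> \<theta>\<^sub>i / \<sigma>\<close> on which \<open>x\<close> lies
  (\<open>err_le_iff\<close>). Hence the conditional cdf given \<open>S = s\<close> is the normal cdf evaluated there.
  It jumps at the atom by the probability that the least squares estimate is thresholded to 0,
  and on both sides of the atom it is differentiable, with the integrand of the asserted
  density as its derivative (\<open>emeasure_err\<close>). Integration over \<open>s\<close> gives the cdf, and with
  Tonelli's theorem the atom and the density.\<close>

section \<open>The scaled chi law and its density\<close>

text \<open>Apart from \<open>z = 0\<close>, the set is covered by the images of a null set under the two inverse
  branches \<open>s \<mapsto> \<plusminus>sqrt (r s\<^sup>2 - c)\<close>. They are differentiable where \<open>r s\<^sup>2 > c\<close>, and differentiable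
  maps preserve null sets.\<close>

lemma null_vimage_radius:
  fixes N :: "real set"
  assumes N: "N \<in> null_sets lborel" and c: "c \<ge> 0" and r: "r > 0"
  shows "{z. sqrt (z\<^sup>2 + c) / sqrt r \<in> N} \<in> null_sets lborel"
proof -
  define N' where "N' = N \<inter> {s. r * s\<^sup>2 > c}"
  define g where "g = (\<lambda>s. sqrt (r * s\<^sup>2 - c))"
  have [measurable]: "N \<in> sets borel"
    using N by (auto simp: null_sets_def)
  have "negligible N"
    using N by (auto simp: negligible_iff_null_sets null_sets_completionI)
  then have neg: "negligible N'"
    unfolding N'_def by (rule negligible_subset) auto
  have diff: "g differentiable_on N'"
  proof (rule differentiable_at_imp_differentiable_on)
    fix s assume "s \<in> N'"
    then have "r * s\<^sup>2 - c > 0" by (simp add: N'_def)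
    then have "(g has_real_derivative (r * (2 * s)) * (inverse (g s) / 2)) (at s)"
      unfolding g_def by (auto intro!: derivative_eq_intros simp: field_simps)
    then show "g differentiable (at s)"
      using real_differentiable_def by blast
  qed
  have "negligible (insert 0 (g ` N' \<union> (\<lambda>s. - g s) ` N'))"
    using diff neg
    by (intro negligible_insert[THEN iffD2] negligible_Un
          negligible_differentiable_image_negligible differentiable_on_minus) auto
  moreover have "{z. sqrt (z\<^sup>2 + c) / sqrt r \<in> N} \<subseteq> insert 0 (g ` N' \<union> (\<lambda>s. - g s) ` N')"
  proof
    fix z assume "z \<in> {z. sqrt (z\<^sup>2 + c) / sqrt r \<in> N}"
    then have s: "sqrt (z\<^sup>2 + c) / sqrt r \<in> N" (is "?s \<in> N") by simp
    have "r * ?s\<^sup>2 = z\<^sup>2 + c"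
      using r c by (simp add: power_divide)
    then have "g ?s = \<bar>z\<bar>" "z \<noteq> 0 \<Longrightarrow> ?s \<in> N'"
      using s by (auto simp: g_def N'_def)
    then show "z \<in> insert 0 (g ` N' \<union> (\<lambda>s. - g s) ` N')"
      by (cases "z = 0"; cases "z > 0") (auto simp: image_iff intro!: bexI[of _ ?s])
  qed
  ultimately have "negligible {z. sqrt (z\<^sup>2 + c) / sqrt r \<in> N}"
    by (rule negligible_subset)
  then show ?thesis
    by (subst null_sets_completion_iff[symmetric]) (auto simp: negligible_iff_null_sets)
qed

interpretation std_normal: real_distribution std_normal_distribution
  by (rule real_dist_normal_dist)

lemma product_sigma_finite_std_normal: "product_sigma_finite (\<lambda>_. std_normal_distribution)"
  by (simp add: product_sigma_finite_def std_normal.sigma_finite_measure_axioms)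

text \<open>For \<open>m = n - k\<close> this turns out to be the law of \<open>\<sigma>_hat / \<sigma>\<close>.\<close>

definition scaled_chi :: "nat \<Rightarrow> real measure" where
  "scaled_chi m = distr (chi_square m) borel (\<lambda>c. sqrt c / sqrt (real m))"

lemma scaled_chi_eq:
  "scaled_chi m = distr (PiM {..<m} (\<lambda>_. std_normal_distribution)) borel
     (\<lambda>z. sqrt (\<Sum>j<m. (z j)\<^sup>2) / sqrt (real m))"
  unfolding scaled_chi_def chi_square_def by (subst distr_distr) (auto simp: comp_def)

lemma sets_scaled_chi [measurable_cong, simp]: "sets (scaled_chi m) = sets borel"
  by (simp add: scaled_chi_def)

interpretation scaled_chi: prob_space "scaled_chi m" for m
  unfolding scaled_chi_eq
  by (intro prob_space.prob_space_distr prob_space_PiM std_normal.prob_space_axioms) auto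

text \<open>One coordinate suffices: by Fubini's theorem it is enough that, with all other coordinates
  fixed, the radius falls into a null set with probability 0.\<close>

lemma absolutely_continuous_scaled_chi:
  assumes "m \<ge> 1"
  shows "absolutely_continuous lborel (scaled_chi m)"
  unfolding absolutely_continuous_def
proof
  fix N :: "real set" assume N: "N \<in> null_sets lborel"
  then have [measurable]: "N \<in> sets borel" by (auto simp: null_sets_def)
  obtain k where m: "m = Suc k" using assms by (cases m) auto
  have ins: "{..<m} = insert k {..<k}" by (auto simp: m)
  let ?f = "\<lambda>z. indicator N (sqrt (\<Sum>j<m. (z j)\<^sup>2) / sqrt (real m)) :: ennreal"
  have [measurable]: "?f \<in> borel_measurable (PiM {..<m} (\<lambda>_. std_normal_distribution))"
    by measurable
  \<comment> \<open>The last coordinate is the one that is integrated first.\<close>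
  have inner: "(\<integral>\<^sup>+y. ?f (x(k := y)) \<partial>std_normal_distribution) = 0" for x :: "nat \<Rightarrow> real"
  proof -
    have eq: "(\<Sum>j<m. ((x(k := y)) j)\<^sup>2) = y\<^sup>2 + (\<Sum>j<k. (x j)\<^sup>2)" for y
      unfolding ins by simp
    have "{y. sqrt (y\<^sup>2 + (\<Sum>j<k. (x j)\<^sup>2)) / sqrt (real m) \<in> N} \<in> null_sets lborel"
      using assms by (intro null_vimage_radius N) (auto intro: sum_nonneg)
    from AE_not_in[OF this] have "AE y in lborel. ?f (x(k := y)) = 0"
      unfolding eq by eventually_elim simp
    then have "(\<integral>\<^sup>+y. ennreal (std_normal_density y) * ?f (x(k := y)) \<partial>lborel) = (\<integral>\<^sup>+(y::real). 0 \<partial>lborel)"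
      by (intro nn_integral_cong_AE) (auto elim!: eventually_mono)
    then show ?thesis
      unfolding eq by (subst nn_integral_density) simp_all
  qed
  have "emeasure (scaled_chi m) N = (\<integral>\<^sup>+s. indicator N s \<partial>scaled_chi m)"
    by simp
  also have "\<dots> = (\<integral>\<^sup>+z. ?f z \<partial>PiM {..<m} (\<lambda>_. std_normal_distribution))"
    unfolding scaled_chi_eq by (rule nn_integral_distr) measurable
  also have "\<dots> = (\<integral>\<^sup>+x. (\<integral>\<^sup>+y. ?f (x(k := y)) \<partial>std_normal_distribution)
                     \<partial>PiM {..<k} (\<lambda>_. std_normal_distribution))"
    unfolding ins by (rule product_sigma_finite.product_nn_integral_insert[OF product_sigma_finite_std_normal]) (auto simp: ins[symmetric])
  also have "\<dots> = 0" unfolding inner by simp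
  finally show "N \<in> null_sets (scaled_chi m)" by (auto simp: null_sets_def)
qed

lemma rho_nonneg [simp]: "rho m s \<ge> 0"
  by (simp add: rho_def)

lemma borel_measurable_rho [measurable]: "rho m \<in> borel_measurable borel"
  unfolding rho_def[abs_def] by measurable

lemma scaled_chi_eq_density_rho:
  assumes "m \<ge> 1"
  shows "scaled_chi m = density lborel (\<lambda>s. ennreal (rho m s))"
proof -
  have ac: "absolutely_continuous lborel (scaled_chi m)"
    by (rule absolutely_continuous_scaled_chi[OF assms])
  have "AE s in lborel. RN_deriv lborel (scaled_chi m) s \<noteq> \<infinity>"
    by (rule sigma_finite_measure.RN_deriv_finite[OF sigma_finite_lborel
          scaled_chi.sigma_finite_measure_axioms ac]) simp
  then have "AE s in lborel. RN_deriv lborel (scaled_chi m) s = ennreal (rho m s)"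
  proof eventually_elim
    case (elim s)
    then show ?case
      unfolding rho_def scaled_chi_def[symmetric]
      by (intro ennreal_enn2real[symmetric]) (simp add: top.not_eq_extremum)
  qed
  then have "density lborel (RN_deriv lborel (scaled_chi m)) = density lborel (\<lambda>s. ennreal (rho m s))"
    by (intro density_cong) measurable
  then show ?thesis
    using sigma_finite_measure.density_RN_deriv[OF sigma_finite_lborel ac] by simp
qed

lemma AE_scaled_chi_pos:
  assumes "m \<ge> 1"
  shows "AE s in scaled_chi m. s > 0"
proof -
  have "AE s in scaled_chi m. s \<ge> 0"
    unfolding scaled_chi_eq by (subst AE_distr_iff) (simp_all add: sum_nonneg)
  moreover have "{0} \<in> null_sets (scaled_chi m)"
    using absolutely_continuous_scaled_chi[OF assms]
    unfolding absolutely_continuous_def by (rule subsetD) (auto simp: null_sets_def)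
  then have "AE s in scaled_chi m. s \<noteq> 0"
    by (auto dest: AE_not_in)
  ultimately show ?thesis by eventually_elim auto
qed

text \<open>The integrals of the cdf and of the density run over the open half-line only; nothing is
  lost, because the law of the scale is concentrated there.\<close>

lemma nn_integral_scaled_chi:
  assumes "m \<ge> 1" and [measurable]: "f \<in> borel_measurable borel"
  shows "(\<integral>\<^sup>+s. f s \<partial>scaled_chi m) = (\<integral>\<^sup>+s\<in>{0<..}. f s * ennreal (rho m s) \<partial>lborel)"
proof -
  have "(\<integral>\<^sup>+s. f s \<partial>scaled_chi m) = (\<integral>\<^sup>+s. f s * indicator {0<..} s \<partial>scaled_chi m)"
    using AE_scaled_chi_pos[OF assms(1)] by (intro nn_integral_cong_AE) (auto elim!: eventually_mono)
  also have "\<dots> = (\<integral>\<^sup>+s\<in>{0<..}. f s * ennreal (rho m s) \<partial>lborel)"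
    unfolding scaled_chi_eq_density_rho[OF assms(1)]
    by (subst nn_integral_density) (auto simp: ac_simps)
  finally show ?thesis .
qed

text \<open>This is how expectations over the scale become the Lebesgue integrals against \<open>rho\<close> of the
  definitions; boundedness makes the latter proper integrals and not default values.\<close>

lemma integral_rho_bounded:
  assumes "m \<ge> 1" and [measurable]: "f \<in> borel_measurable borel"
    and b: "\<And>s. s > 0 \<Longrightarrow> 0 \<le> f s" "\<And>s. s > 0 \<Longrightarrow> f s \<le> B"
  shows "(\<integral>\<^sup>+s. ennreal (f s) \<partial>scaled_chi m) = ennreal (LBINT s:{0<..}. f s * rho m s)"
proof -
  have pos: "AE s in scaled_chi m. s > 0" by (rule AE_scaled_chi_pos[OF assms(1)])
  have B: "B \<ge> 0" using b(1)[of 1] b(2)[of 1] by simp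
  have "(\<integral>\<^sup>+s. ennreal (f s) \<partial>scaled_chi m) \<le> (\<integral>\<^sup>+s. ennreal B \<partial>scaled_chi m)"
    using pos b by (intro nn_integral_mono_AE) (auto elim!: eventually_mono intro: ennreal_leI)
  also have "\<dots> < \<infinity>" by (simp add: scaled_chi.emeasure_space_1 ennreal_mult_less_top)
  finally have fin: "(\<integral>\<^sup>+s. ennreal (f s) \<partial>scaled_chi m) < \<infinity>" .
  have eq: "(\<integral>\<^sup>+s. ennreal (f s) \<partial>scaled_chi m)
     = (\<integral>\<^sup>+s. ennreal (indicator {0<..} s *\<^sub>R (f s * rho m s)) \<partial>lborel)"
    by (subst nn_integral_scaled_chi[OF assms(1)])
       (auto intro!: nn_integral_cong simp: indicator_def ennreal_mult' b)
  have nn: "0 \<le> indicator {0<..} s *\<^sub>R (f s * rho m s)" for s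
    by (auto simp: indicator_def b)
  have "integrable lborel (\<lambda>s. indicator {0<..} s *\<^sub>R (f s * rho m s))"
    using fin nn unfolding eq by (intro integrableI_nonneg) auto
  then show ?thesis
    unfolding set_lebesgue_integral_def eq using nn by (intro nn_integral_eq_integral) auto
qed

section \<open>Rotation invariance of the standard Gaussian law\<close>

text \<open>Both measures are translation invariant and give the same finite mass to the unit ball \<open>B\<close>.
  Evaluating the double integral of \<open>1\<^sub>A (f x) 1\<^sub>B y\<close>, shifting \<open>x\<close>, then \<open>y\<close>, and exchanging
  the order of integration shows that they agree on \<open>A\<close> once the common mass of \<open>B\<close> is cancelled.\<close>

lemma lborel_distr_orthogonal:
  fixes f :: "'a::euclidean_space \<Rightarrow> 'a"
  assumes f: "orthogonal_transformation f"
  shows "distr lborel borel f = lborel"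
proof (rule measure_eqI)
  show "sets (distr lborel borel f) = sets lborel" by simp
  fix A assume "A \<in> sets (distr lborel borel f)"
  then have [measurable]: "A \<in> sets borel" by simp
  have lin: "linear f" using f by (rule orthogonal_transformation_linear)
  have [measurable]: "f \<in> borel_measurable borel"
    using lin by (intro borel_measurable_continuous_onI linear_continuous_on)
      (simp add: linear_conv_bounded_linear)
  define g where "g = inv f"
  have fg: "f (g y) = y" for y
    unfolding g_def using orthogonal_transformation_surj[OF f] by (simp add: surj_f_inv_f)
  define B where "B = ball (0::'a) 1"
  have [measurable]: "B \<in> sets borel" by (simp add: B_def)
  have B: "emeasure lborel (ball c 1) = emeasure lborel B" for c :: 'a
    by (simp add: B_def emeasure_ball)
  have B0: "emeasure lborel B \<noteq> 0" "emeasure lborel B \<noteq> \<infinity>"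
    using content_ball_pos[of 1 "0::'a"] emeasure_lborel_ball_finite[of "0::'a" 1]
    by (auto simp: B_def measure_def)
  have shift: "(\<integral>\<^sup>+x. h (x + c) \<partial>lborel) = (\<integral>\<^sup>+x. h x \<partial>lborel)"
    if "h \<in> borel_measurable borel" for h :: "'a \<Rightarrow> ennreal" and c
    using that by (subst lborel_distr_plus[of c, symmetric], subst nn_integral_distr)
      (auto simp: add.commute)
  \<comment> \<open>The shift of \<open>x\<close> by \<open>g y\<close> moves \<open>y\<close> into the argument of the indicator of \<open>A\<close>; the shift
     of \<open>y\<close> by \<open>f x\<close> frees it again.\<close>
  let ?I = "indicator :: 'a set \<Rightarrow> 'a \<Rightarrow> ennreal"
  have "emeasure (distr lborel borel f) A * emeasure lborel B
      = (\<integral>\<^sup>+y. (\<integral>\<^sup>+x. ?I A (f x) * ?I B y \<partial>lborel) \<partial>lborel)"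
    by (simp add: nn_integral_multc nn_integral_cmult nn_integral_indicator[symmetric]
        nn_integral_distr del: nn_integral_indicator)
  also have "\<dots> = (\<integral>\<^sup>+y. (\<integral>\<^sup>+x. ?I A (f x + y) * ?I B y \<partial>lborel) \<partial>lborel)"
  proof (rule nn_integral_cong)
    fix y :: 'a
    show "(\<integral>\<^sup>+x. ?I A (f x) * ?I B y \<partial>lborel) = (\<integral>\<^sup>+x. ?I A (f x + y) * ?I B y \<partial>lborel)"
      using shift[of "\<lambda>x. ?I A (f x) * ?I B y" "g y"] lin by (simp add: linear_add fg)
  qed
  also have "\<dots> = (\<integral>\<^sup>+x. (\<integral>\<^sup>+y. ?I A (y + f x) * ?I B y \<partial>lborel) \<partial>lborel)"
    by (subst lborel_pair.Fubini') (auto simp: add.commute)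
  also have "\<dots> = (\<integral>\<^sup>+x. (\<integral>\<^sup>+y. ?I A y * ?I B (y - f x) \<partial>lborel) \<partial>lborel)"
  proof (rule nn_integral_cong)
    fix x :: 'a
    show "(\<integral>\<^sup>+y. ?I A (y + f x) * ?I B y \<partial>lborel) = (\<integral>\<^sup>+y. ?I A y * ?I B (y - f x) \<partial>lborel)"
      using shift[of "\<lambda>y. ?I A y * ?I B (y - f x)" "f x"] by simp
  qed
  also have "\<dots> = (\<integral>\<^sup>+y. (\<integral>\<^sup>+x. ?I A y * ?I B (y - f x) \<partial>lborel) \<partial>lborel)"
    by (rule lborel_pair.Fubini') auto
  also have "\<dots> = (\<integral>\<^sup>+y. ?I A y * emeasure lborel B \<partial>lborel)"
  proof (rule nn_integral_cong)
    fix y :: 'a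
    have "?I B (y - f x) = ?I (ball (g y) 1) x" for x
    proof -
      have "y - f x = f (g y - x)" using lin by (simp add: linear_diff fg)
      then show ?thesis
        by (simp add: B_def indicator_def dist_norm orthogonal_transformation_norm[OF f])
    qed
    then show "(\<integral>\<^sup>+x. ?I A y * ?I B (y - f x) \<partial>lborel) = ?I A y * emeasure lborel B"
      by (simp add: nn_integral_cmult_indicator B)
  qed
  also have "\<dots> = emeasure lborel A * emeasure lborel B"
    by (simp add: nn_integral_multc)
  finally show "emeasure (distr lborel borel f) A = emeasure lborel A"
    using B0 by (simp add: mult.commute[of _ "emeasure lborel B"] ennreal_mult_cancel_left)
qed

lemma borel_measurable_vec_lambda [measurable (raw)]:
  fixes f :: "'b \<Rightarrow> 'n::finite \<Rightarrow> real"
  assumes "\<And>i. (\<lambda>x. f x i) \<in> borel_measurable M"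
  shows "(\<lambda>x. \<chi> i. f x i) \<in> borel_measurable M"
  using assms by (subst borel_measurable_euclidean_space)
    (auto simp: Basis_vec_def inner_axis)

lemma borel_measurable_vec_nth [measurable (raw)]:
  fixes f :: "'b \<Rightarrow> real^'n"
  assumes "f \<in> borel_measurable M"
  shows "(\<lambda>x. f x $ i) \<in> borel_measurable M"
  using assms by (subst (asm) borel_measurable_euclidean_space)
    (auto simp: Basis_vec_def inner_axis)

lemma product_sigma_finite_lborel: "product_sigma_finite (\<lambda>_. lborel)"
  by (simp add: product_sigma_finite_def sigma_finite_lborel)

text \<open>Product measures over the index type are easier to handle than over the basis vectors:
  this is the bridge between them.\<close>

lemma lborel_vec_eq_distr_PiM:
  "(lborel :: (real^'n) measure)
     = distr (PiM (UNIV :: 'n set) (\<lambda>_. lborel)) borel (\<lambda>f. \<chi> i. f i)"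
proof (rule lborel_eqI)
  fix l u :: "real^'n" assume le: "\<And>b. b \<in> Basis \<Longrightarrow> l \<bullet> b \<le> u \<bullet> b"
  have le': "l $ i \<le> u $ i" for i
    using le[of "axis i 1"] by (auto simp: Basis_vec_def inner_axis)
  have "emeasure (distr (PiM (UNIV :: 'n set) (\<lambda>_. lborel)) borel (\<lambda>f. \<chi> i. f i)) (box l u)
     = emeasure (PiM (UNIV :: 'n set) (\<lambda>_. lborel)) (PiE UNIV (\<lambda>i. {l $ i <..< u $ i}))"
    by (subst emeasure_distr)
       (auto simp: mem_box_cart space_PiM PiE_iff intro!: arg_cong2[where f = emeasure])
  also have "\<dots> = (\<Prod>i\<in>UNIV. ennreal (u $ i - l $ i))"
    by (subst product_sigma_finite.emeasure_PiM[OF product_sigma_finite_lborel]) (auto simp: le')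
  also have "\<dots> = ennreal (\<Prod>i\<in>UNIV. (u - l) $ i)"
    by (subst prod_ennreal) (auto simp: le')
  also have "(\<Prod>i\<in>UNIV. (u - l) $ i) = (\<Prod>b\<in>Basis. (u - l) \<bullet> b)"
    by (rule prod.reindex_bij_witness[of _ "\<lambda>b. THE i. b = axis i 1" "\<lambda>i. axis i 1"])
       (auto simp: Basis_vec_def inner_axis axis_eq_axis)
  finally show "emeasure (distr (PiM (UNIV :: 'n set) (\<lambda>_. lborel)) borel (\<lambda>f. \<chi> i. f i)) (box l u)
     = ennreal (\<Prod>b\<in>Basis. (u - l) \<bullet> b)" .
qed simp

lemma PiM_density_lborel:
  fixes p :: "'i::finite \<Rightarrow> real \<Rightarrow> real"
  assumes [measurable]: "\<And>i. p i \<in> borel_measurable borel" and nn: "\<And>i x. p i x \<ge> 0"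
    and P: "\<And>i. prob_space (density lborel (p i))"
  shows "PiM UNIV (\<lambda>i. density lborel (\<lambda>x. ennreal (p i x)))
    = density (PiM UNIV (\<lambda>_. lborel)) (\<lambda>x. ennreal (\<Prod>i\<in>UNIV. p i (x i)))"
proof (rule sym, rule product_sigma_finite.PiM_eqI)
  show "product_sigma_finite (\<lambda>i. density lborel (\<lambda>x. ennreal (p i x)))"
    using P by (simp add: product_sigma_finite_def prob_space_imp_sigma_finite)
  show "sets (density (PiM UNIV (\<lambda>_. lborel)) (\<lambda>x. ennreal (\<Prod>i\<in>UNIV. p i (x i))))
     = sets (PiM UNIV (\<lambda>i. density lborel (\<lambda>x. ennreal (p i x))))"
    by (simp cong: sets_PiM_cong)
  fix A :: "'i \<Rightarrow> real set"
  assume "\<And>i. i \<in> UNIV \<Longrightarrow> A i \<in> sets (density lborel (\<lambda>x. ennreal (p i x)))"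
  then have [measurable]: "A i \<in> sets borel" for i by simp
  have "emeasure (density (PiM UNIV (\<lambda>_. lborel)) (\<lambda>x. ennreal (\<Prod>i\<in>UNIV. p i (x i)))) (PiE UNIV A)
     = (\<integral>\<^sup>+x. ennreal (\<Prod>i\<in>UNIV. p i (x i)) * indicator (PiE UNIV A) x \<partial>PiM UNIV (\<lambda>_. lborel))"
    by (subst emeasure_density) (auto intro!: sets_PiM_I_finite)
  also have "\<dots> = (\<integral>\<^sup>+x. (\<Prod>i\<in>UNIV. ennreal (p i (x i)) * indicator (A i) (x i)) \<partial>PiM UNIV (\<lambda>_. lborel))"
    by (intro nn_integral_cong)
       (auto simp: prod_ennreal[symmetric] nn prod.distrib indicator_def PiE_iff)
  also have "\<dots> = (\<Prod>i\<in>UNIV. \<integral>\<^sup>+x. ennreal (p i x) * indicator (A i) x \<partial>lborel)"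
    by (rule product_sigma_finite.product_nn_integral_prod[OF product_sigma_finite_lborel]) auto
  also have "\<dots> = (\<Prod>i\<in>UNIV. emeasure (density lborel (\<lambda>x. ennreal (p i x))) (A i))"
    by (intro prod.cong refl) (subst emeasure_density; simp)
  finally show "emeasure (density (PiM UNIV (\<lambda>_. lborel)) (\<lambda>x. ennreal (\<Prod>i\<in>UNIV. p i (x i)))) (PiE UNIV A)
     = (\<Prod>i\<in>UNIV. emeasure (density lborel (\<lambda>x. ennreal (p i x))) (A i))" .
qed simp

definition std_gaussian :: "(real^'n) measure" where
  "std_gaussian = distr (PiM (UNIV :: 'n set) (\<lambda>_. std_normal_distribution)) borel (\<lambda>f. \<chi> i. f i)"

text \<open>The density depends on the norm only, which is the reason for rotation invariance.\<close>

lemma std_gaussian_density: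
  "std_gaussian = density lborel
     (\<lambda>z::real^'n. ennreal ((1 / sqrt (2 * pi)) ^ CARD('n) * exp (- (norm z)\<^sup>2 / 2)))"
proof -
  have prod: "(\<Prod>i\<in>UNIV. std_normal_density (z $ i))
      = (1 / sqrt (2 * pi)) ^ CARD('n) * exp (- (norm z)\<^sup>2 / 2)" for z :: "real^'n"
  proof -
    have "(\<Prod>i\<in>UNIV. std_normal_density (z $ i))
        = (1 / sqrt (2 * pi)) ^ CARD('n) * exp (\<Sum>i\<in>UNIV. - (z $ i)\<^sup>2 / 2)"
      unfolding std_normal_density_def by (simp add: prod.distrib exp_sum prod_dividef power_divide)
    also have "(\<Sum>i\<in>UNIV. - (z $ i)\<^sup>2 / 2) = - (norm z)\<^sup>2 / 2"
      by (simp add: norm_vec_def L2_set_def sum_nonneg sum_negf sum_divide_distrib[symmetric])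
    finally show ?thesis .
  qed
  have "std_gaussian = distr (density (PiM (UNIV :: 'n set) (\<lambda>_. lborel))
     (\<lambda>x. ennreal (\<Prod>i\<in>UNIV. std_normal_density (x i)))) borel (\<lambda>f. \<chi> i. f i)"
    unfolding std_gaussian_def
    by (subst PiM_density_lborel) (auto intro: prob_space_normal_density)
  also have "\<dots> = density lborel (\<lambda>z::real^'n. ennreal (\<Prod>i\<in>UNIV. std_normal_density (z $ i)))"
    unfolding lborel_vec_eq_distr_PiM by (subst density_distr) auto
  finally show ?thesis unfolding prod .
qed

lemma std_gaussian_rotation_invariant:
  fixes f :: "real^'n \<Rightarrow> real^'n"
  assumes f: "orthogonal_transformation f"
  shows "distr std_gaussian borel f = std_gaussian"
proof -
  let ?d = "\<lambda>z::real^'n. ennreal ((1 / sqrt (2 * pi)) ^ CARD('n) * exp (- (norm z)\<^sup>2 / 2))"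
  have "linear f" using f by (rule orthogonal_transformation_linear)
  then have [measurable]: "f \<in> borel_measurable borel"
    by (intro borel_measurable_continuous_onI linear_continuous_on)
      (simp add: linear_conv_bounded_linear)
  have "density (distr lborel borel f) ?d = distr (density lborel (\<lambda>z. ?d (f z))) borel f"
    by (rule density_distr) auto
  then show ?thesis
    by (simp add: lborel_distr_orthogonal[OF f] std_gaussian_density orthogonal_transformation_norm[OF f])
qed

section \<open>Independent linear and quadratic functions of a Gaussian vector\<close>

lemma indep_vars_coordinates_PiM:
  assumes N: "\<And>i. prob_space (N i)"
  shows "prob_space.indep_vars (PiM (UNIV :: 'i set) N) N (\<lambda>i x. x i) UNIV"
proof -
  have P: "prob_space (PiM (UNIV :: 'i set) N)"
    by (rule prob_space_PiM) (rule N)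
  have "distr (PiM UNIV N) (PiM UNIV N) (\<lambda>x. \<lambda>i\<in>UNIV. x i) = PiM UNIV N"
    by (simp add: restrict_UNIV)
  moreover have "(\<lambda>i. distr (PiM UNIV N) (N i) (\<lambda>x. x i)) = N"
    by (intro ext distr_PiM_component N UNIV_I)
  ultimately show ?thesis
    by (subst prob_space.indep_vars_iff_distr_eq_PiM[OF P]) auto
qed

lemma distr_PiM_scaled_chi:
  fixes J :: "'i set"
  assumes J: "finite J" 
  shows "distr (PiM (UNIV :: 'i set) (\<lambda>_. std_normal_distribution)) borel
    (\<lambda>x. sqrt (\<Sum>j\<in>J. (x j)\<^sup>2) / sqrt (real (card J))) = scaled_chi (card J)"
proof -
  let ?N = "\<lambda>_. std_normal_distribution"
  obtain h where h: "bij_betw h {..<card J} J"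
    using ex_bij_betw_nat_finite[OF J] by (auto simp: atLeast0LessThan)
  have "PiM {..<card J} ?N = distr (PiM (UNIV :: 'i set) ?N) (PiM {..<card J} ?N)
      (\<lambda>x. \<lambda>n\<in>{..<card J}. x (h n))"
    using h by (intro distr_PiM_reindex[symmetric] std_normal.prob_space_axioms) (auto simp: bij_betw_def)
  then have "scaled_chi (card J) = distr (distr (PiM (UNIV :: 'i set) ?N) (PiM {..<card J} ?N)
      (\<lambda>x. \<lambda>n\<in>{..<card J}. x (h n))) borel
      (\<lambda>z. sqrt (\<Sum>j<card J. (z j)\<^sup>2) / sqrt (real (card J)))"
    unfolding scaled_chi_eq by simp
  also have "\<dots> = distr (PiM (UNIV :: 'i set) ?N) borel
      (\<lambda>x. sqrt (\<Sum>n<card J. (x (h n))\<^sup>2) / sqrt (real (card J)))"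
    by (subst distr_distr) (auto simp: comp_def intro!: distr_cong)
  also have "(\<lambda>x::'i \<Rightarrow> real. \<Sum>n<card J. (x (h n))\<^sup>2) = (\<lambda>x. \<Sum>j\<in>J. (x j)\<^sup>2)"
    by (intro ext sum.reindex_bij_betw[OF h])
  then have "distr (PiM (UNIV :: 'i set) ?N) borel
      (\<lambda>x. sqrt (\<Sum>n<card J. (x (h n))\<^sup>2) / sqrt (real (card J)))
     = distr (PiM (UNIV :: 'i set) ?N) borel (\<lambda>x. sqrt (\<Sum>j\<in>J. (x j)\<^sup>2) / sqrt (real (card J)))"
    by (simp add: fun_eq_iff)
  finally show ?thesis by simp
qed

text \<open>For coordinate vectors the claim on the joint law is immediate: disjoint blocks of independent
  coordinates are independent.\<close>

lemma joint_law_coordinates: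
  fixes J :: "'i::finite set"
  assumes j0: "j0 \<notin> J"
  shows "distr (PiM (UNIV :: 'i set) (\<lambda>_. std_normal_distribution)) (borel \<Otimes>\<^sub>M borel)
      (\<lambda>x. (x j0, sqrt (\<Sum>j\<in>J. (x j)\<^sup>2) / sqrt (real (card J))))
    = std_normal_distribution \<Otimes>\<^sub>M scaled_chi (card J)"
proof -
  let ?P = "PiM (UNIV :: 'i set) (\<lambda>_. std_normal_distribution)"
  have P: "prob_space ?P" by (intro prob_space_PiM std_normal.prob_space_axioms)
  have "prob_space.indep_var ?P (PiM {j0} (\<lambda>_. std_normal_distribution)) (\<lambda>x. restrict x {j0})
      (PiM J (\<lambda>_. std_normal_distribution)) (\<lambda>x. restrict x J)"
    using prob_space.indep_var_restrict[OF P indep_vars_coordinates_PiM[OF std_normal.prob_space_axioms], of "{j0}" J] j0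
    by simp
  then have "prob_space.indep_var ?P borel ((\<lambda>x. x j0) \<circ> (\<lambda>x. restrict x {j0}))
      borel ((\<lambda>x. sqrt (\<Sum>j\<in>J. (x j)\<^sup>2) / sqrt (real (card J))) \<circ> (\<lambda>x. restrict x J))"
    by (rule prob_space.indep_var_compose[OF P]) measurable
  then have "prob_space.indep_var ?P borel (\<lambda>x. x j0) borel (\<lambda>x. sqrt (\<Sum>j\<in>J. (x j)\<^sup>2) / sqrt (real (card J)))"
    by (simp add: comp_def)
  then have "distr ?P (borel \<Otimes>\<^sub>M borel) (\<lambda>x. (x j0, sqrt (\<Sum>j\<in>J. (x j)\<^sup>2) / sqrt (real (card J))))
    = distr ?P borel (\<lambda>x. x j0) \<Otimes>\<^sub>M distr ?P borel (\<lambda>x. sqrt (\<Sum>j\<in>J. (x j)\<^sup>2) / sqrt (real (card J)))"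
    by (simp add: prob_space.indep_var_distribution_eq[OF P])
  moreover have "distr ?P borel (\<lambda>x. x j0) = distr ?P std_normal_distribution (\<lambda>x. x j0)"
    by (rule distr_cong) auto
  then have "distr ?P borel (\<lambda>x. x j0) = std_normal_distribution"
    using distr_PiM_component[of UNIV "\<lambda>_::'i. std_normal_distribution" j0] std_normal.prob_space_axioms
    by simp
  ultimately show ?thesis by (simp add: distr_PiM_scaled_chi)
qed

text \<open>Add an orthonormal basis of the orthogonal complement.\<close>

lemma orthonormal_set_extend:
  fixes S :: "'a::euclidean_space set"
  assumes orth: "pairwise orthogonal S" and norm: "\<And>x. x \<in> S \<Longrightarrow> norm x = 1"
  obtains T where "S \<subseteq> T" "finite T" "card T = DIM('a)" "pairwise orthogonal T"
    "\<And>x. x \<in> T \<Longrightarrow> norm x = 1"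
proof -
  have ind: "independent S"
    using orth norm by (intro pairwise_orthogonal_independent) force+
  let ?D = "{y \<in> UNIV. \<forall>x\<in>span S. orthogonal x y}"
  have "subspace ?D"
    by (auto simp: subspace_def orthogonal_clauses)
  then obtain D where D: "D \<subseteq> ?D" "pairwise orthogonal D" "\<And>x. x \<in> D \<Longrightarrow> norm x = 1"
    "independent D" "card D = dim ?D"
    by (rule orthonormal_basis_subspace) blast
  have SD: "orthogonal x y" if "x \<in> S" "y \<in> D" for x y
    using that D(1) span_base[OF that(1)] by auto
  show ?thesis
  proof (rule that[of "S \<union> D"])
    have "S \<inter> D = {}"
      using SD norm orthogonal_self by (metis disjoint_iff norm_zero zero_neq_one)
    moreover have "finite S" "finite D" using ind D(4) by (auto intro: independent_imp_finite)
    moreover have "card S = dim (span S)" using ind by (simp add: dim_eq_card_independent)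
    moreover have "dim ?D + dim (span S) = dim (UNIV :: 'a set)"
      by (rule dim_subspace_orthogonal_to_vectors) auto
    ultimately show "card (S \<union> D) = DIM('a)" "finite (S \<union> D)"
      using D(5) by (auto simp: card_Un_disjoint)
    show "pairwise orthogonal (S \<union> D)"
      using orth D(2) SD unfolding pairwise_def by (metis Un_iff orthogonal_commute)
  qed (use norm D(3) in auto)
qed

lemma orthogonal_transformation_coordinates:
  fixes e :: "'n::finite \<Rightarrow> real^'n"
  assumes "\<And>j. norm (e j) = 1" "\<And>i j. i \<noteq> j \<Longrightarrow> orthogonal (e i) (e j)"
  shows "orthogonal_transformation (\<lambda>z. \<chi> j. e j \<bullet> z)"
proof -
  define Q :: "real^'n^'n" where "Q = (\<chi> j. e j)"
  have "row j Q = e j" for j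
    by (simp add: row_def Q_def vec_eq_iff)
  then have "orthogonal_matrix Q"
    using assms by (simp add: orthogonal_matrix_orthonormal_rows)
  then have "orthogonal_transformation ((*v) Q)"
    by (simp add: orthogonal_transformation_matrix)
  moreover have "(*v) Q = (\<lambda>z. \<chi> j. e j \<bullet> z)"
    by (simp add: fun_eq_iff vec_eq_iff matrix_vector_mul_component Q_def)
  ultimately show ?thesis by simp
qed

text \<open>Extend \<open>{a} \<union> B\<close> to an orthonormal basis and pass to the coordinates with respect to it.
  By rotation invariance they are again independent standard normal variables.\<close>

lemma joint_law_std_gaussian:
  fixes a :: "real^'n" and B :: "(real^'n) set"
  assumes a: "norm a = 1" and B: "pairwise orthogonal B" "\<And>b. b \<in> B \<Longrightarrow> norm b = 1"
    and aB: "\<And>b. b \<in> B \<Longrightarrow> orthogonal a b"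
  shows "distr std_gaussian (borel \<Otimes>\<^sub>M borel)
      (\<lambda>z. (a \<bullet> z, sqrt (\<Sum>b\<in>B. (b \<bullet> z)\<^sup>2) / sqrt (real (card B))))
    = std_normal_distribution \<Otimes>\<^sub>M scaled_chi (card B)"
proof -
  have orth: "pairwise orthogonal (insert a B)"
    using B(1) aB by (simp add: pairwise_insert orthogonal_commute)
  have unit: "norm x = 1" if "x \<in> insert a B" for x
    using that a B(2) by blast
  obtain T where T: "insert a B \<subseteq> T" "finite T" "card T = DIM(real^'n)"
    "pairwise orthogonal T" "\<And>x. x \<in> T \<Longrightarrow> norm x = 1"
    by (rule orthonormal_set_extend[OF orth unit]; (rule that; assumption)?)
  have "card (UNIV :: 'n set) = card T" using T(3) by simp
  then obtain e where e: "bij_betw e (UNIV :: 'n set) T"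
    using finite_same_card_bij[OF finite T(2)] by blast
  have eT: "e j \<in> T" for j using e by (auto simp: bij_betw_def)
  have f: "orthogonal_transformation (\<lambda>z. \<chi> j. e j \<bullet> z)" (is "orthogonal_transformation ?f")
  proof (rule orthogonal_transformation_coordinates)
    show "norm (e j) = 1" for j by (rule T(5)[OF eT])
    show "orthogonal (e i) (e j)" if "i \<noteq> j" for i j
      using pairwiseD[OF T(4) eT eT] that bij_betw_imp_inj_on[OF e] by (simp add: inj_eq)
  qed
  have [measurable]: "?f \<in> borel_measurable borel" by measurable
  obtain j0 where j0: "e j0 = a"
    using bij_betw_imp_surj_on[OF e] T(1) by blast
  define J where "J = e -` B"
  have J: "bij_betw e J B"
  proof (rule bij_betw_subset[OF e])
    show "e ` J = B"
      using bij_betw_imp_surj_on[OF e] T(1) unfolding J_def by blast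
  qed simp
  have sumJ: "(\<Sum>b\<in>B. (b \<bullet> z)\<^sup>2) = (\<Sum>j\<in>J. (e j \<bullet> z)\<^sup>2)" for z
    by (rule sum.reindex_bij_betw[OF J, symmetric])
  have "a \<notin> B"
  proof
    assume "a \<in> B"
    then have "orthogonal a a" by (rule aB)
    then show False using a by (simp add: orthogonal_self)
  qed
  then have "j0 \<notin> J" unfolding J_def vimage_eq j0 .
  let ?g = "\<lambda>z::real^'n. (z $ j0, sqrt (\<Sum>j\<in>J. (z $ j)\<^sup>2) / sqrt (real (card J)))"
  have "distr std_gaussian (borel \<Otimes>\<^sub>M borel)
      (\<lambda>z. (a \<bullet> z, sqrt (\<Sum>b\<in>B. (b \<bullet> z)\<^sup>2) / sqrt (real (card B))))
    = distr std_gaussian (borel \<Otimes>\<^sub>M borel) (?g \<circ> ?f)"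
    by (simp add: comp_def sumJ bij_betw_same_card[OF J] j0)
  also have "\<dots> = distr (distr std_gaussian borel ?f) (borel \<Otimes>\<^sub>M borel) ?g"
    by (rule distr_distr[symmetric]) (auto simp: std_gaussian_def)
  also have "\<dots> = distr std_gaussian (borel \<Otimes>\<^sub>M borel) ?g"
    by (simp add: std_gaussian_rotation_invariant[OF f])
  also have "\<dots> = distr (PiM (UNIV :: 'n set) (\<lambda>_. std_normal_distribution)) (borel \<Otimes>\<^sub>M borel)
      (\<lambda>x. (x j0, sqrt (\<Sum>j\<in>J. (x j)\<^sup>2) / sqrt (real (card J))))"
    unfolding std_gaussian_def by (subst distr_distr) (auto simp: comp_def)
  also have "\<dots> = std_normal_distribution \<Otimes>\<^sub>M scaled_chi (card J)"
    by (rule joint_law_coordinates) fact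
  finally show ?thesis using bij_betw_same_card[OF J] by simp
qed

text \<open>Independent components are turned into a product measure, which is how \<open>std_gaussian\<close> is given.\<close>

lemma (in prob_space) std_gaussian_scaled_noise:
  fixes u :: "'a \<Rightarrow> real^'n"
  assumes \<sigma>: "\<sigma> > 0"
    and ind: "indep_vars (\<lambda>_. borel) (\<lambda>j \<omega>. u \<omega> $ j) UNIV"
    and d: "\<And>j. distributed M lborel (\<lambda>\<omega>. u \<omega> $ j) (normal_density 0 \<sigma>)"
  shows "distr M borel (\<lambda>\<omega>. u \<omega> /\<^sub>R \<sigma>) = std_gaussian"
proof -
  have [measurable]: "(\<lambda>\<omega>. u \<omega> $ j) \<in> borel_measurable M" for j
    using distributed_measurable[OF d[of j]] by simp
  have std: "distr M borel (\<lambda>\<omega>. u \<omega> $ j / \<sigma>) = std_normal_distribution" for j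
  proof -
    have "distributed M lborel (\<lambda>\<omega>. (u \<omega> $ j - 0) / \<sigma>) std_normal_density"
      by (rule iffD1[OF normal_standard_normal_convert[OF \<sigma>] d])
    then have "distr M lborel (\<lambda>\<omega>. u \<omega> $ j / \<sigma>) = std_normal_distribution"
      using distributed_distr_eq_density by fastforce
    moreover have "distr M lborel (\<lambda>\<omega>. u \<omega> $ j / \<sigma>) = distr M borel (\<lambda>\<omega>. u \<omega> $ j / \<sigma>)"
      by (rule distr_cong) auto
    ultimately show ?thesis by simp
  qed
  have "indep_vars (\<lambda>_. borel) (\<lambda>j \<omega>. u \<omega> $ j / \<sigma>) UNIV"
    using indep_vars_compose2[OF ind, of "\<lambda>_ x. x / \<sigma>"] by simp
  then have *: "distr M (PiM UNIV (\<lambda>_. borel)) (\<lambda>\<omega>. \<lambda>j\<in>UNIV. u \<omega> $ j / \<sigma>)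
      = PiM (UNIV :: 'n set) (\<lambda>_. std_normal_distribution)"
    by (subst (asm) indep_vars_iff_distr_eq_PiM) (auto simp: std)
  show ?thesis
    unfolding std_gaussian_def *[symmetric]
    by (subst distr_distr) (auto simp: comp_def vec_eq_iff divide_inverse mult.commute intro!: distr_cong)
qed

section \<open>Least squares as orthogonal projection\<close>

lemma matrix_inv_eqI:
  fixes A B :: "real^'n^'n"
  assumes "B ** A = mat 1"
  shows "matrix_inv A = B"
  unfolding matrix_inv_def
proof (rule some_equality)
  show "A ** B = mat 1 \<and> B ** A = mat 1"
    using assms matrix_left_right_inverse by blast
  fix C assume "A ** C = mat 1 \<and> C ** A = mat 1"
  then show "C = B"
    using assms by (metis matrix_mul_assoc matrix_mul_rid)
qed

lemma inner_range_transpose: "(X *v v) \<bullet> y = v \<bullet> (transpose X *v y)"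
  for X :: "real^'k^'n"
  using dot_lmul_matrix[of y X v] by (simp add: inner_commute)

text \<open>With \<open>A = X' X\<close> and \<open>G = A\<inverse>\<close> the vector is \<open>c = X G e\<^sub>i\<close>; its squared norm is
  \<open>e\<^sub>i \<bullet> G A G e\<^sub>i = G\<^sub>i\<^sub>i\<close>, which is the source of \<open>\<xi>\<^sub>i\<close>. The residual is the orthogonal
  projection of the noise onto the complement of the column space, so Parseval's identity gives
  \<open>sigma_hat\<close>.\<close>

lemma regression_geometry:
  fixes X :: "real^'k^'n" and i :: 'k
  assumes rank: "rank X = CARD('k)"
  obtains c :: "real^'n" and B :: "(real^'n) set"
  where "\<And>\<theta> y. ls_estimator X (X *v \<theta> + y) $ i = \<theta> $ i + c \<bullet> y"
    "c \<noteq> 0" "xi X i = sqrt (real CARD('n)) * norm c"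
    "finite B" "card B + CARD('k) = CARD('n)" "pairwise orthogonal B" "\<And>b. b \<in> B \<Longrightarrow> norm b = 1"
    "\<And>b. b \<in> B \<Longrightarrow> orthogonal c b"
    "\<And>\<theta> y. sigma_hat X (X *v \<theta> + y)
        = sqrt (\<Sum>b\<in>B. (b \<bullet> y)\<^sup>2) / sqrt (real CARD('n) - real CARD('k))"
proof -
  define A where "A = transpose X ** X"
  have A_mult: "A *v v = transpose X *v (X *v v)" for v
    by (simp add: A_def matrix_vector_mul_assoc del: transpose_matrix_vector)
  have "v = 0" if "A *v v = 0" for v
  proof -
    have "(X *v v) \<bullet> (X *v v) = v \<bullet> (A *v v)"
      by (simp add: inner_range_transpose A_mult del: transpose_matrix_vector)
    then have "X *v v = X *v 0" using that by simp
    moreover have "inj ((*v) X)" using rank by (simp add: full_rank_injective)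
    ultimately show "v = 0" by (rule injD[rotated])
  qed
  then obtain G where GA: "G ** A = mat 1"
    using matrix_left_invertible_ker[of A] by blast
  then have AG: "A ** G = mat 1" using matrix_left_right_inverse by blast
  have inv: "matrix_inv A = G" by (rule matrix_inv_eqI[OF GA])
  have inv': "matrix_inv ((1 / real CARD('n)) *\<^sub>R A) = real CARD('n) *\<^sub>R G"
    using GA by (intro matrix_inv_eqI) (simp add: scalar_matrix_assoc[symmetric] matrix_scalar_ac)
  have "transpose A = A" by (simp add: A_def matrix_transpose_mul)
  then have "transpose G ** A = mat 1"
    using AG by (metis matrix_transpose_mul transpose_mat)
  then have sym: "transpose G = G"
    using inv matrix_inv_eqI by metis
  have GAv: "G *v (A *v v) = v" for v
    by (simp add: matrix_vector_mul_assoc GA)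
  have AGv: "A *v (G *v v) = v" for v
    by (simp add: matrix_vector_mul_assoc AG)
  define c where "c = X *v (G *v axis i 1)"
  have ls: "ls_estimator X (X *v \<theta> + y) = \<theta> + G *v (transpose X *v y)" for \<theta> y
  proof -
    have "ls_estimator X (X *v \<theta> + y) = G *v (A *v \<theta>) + G *v (transpose X *v y)"
      unfolding ls_estimator_def A_def[symmetric] inv A_mult
      by (simp add: matrix_vector_right_distrib del: transpose_matrix_vector)
    then show ?thesis by (simp add: GAv)
  qed
  have G_swap: "(G *v v) \<bullet> w = v \<bullet> (G *v w)" for v w
    using inner_range_transpose[of G v w] sym by simp
  have c_inner: "c \<bullet> y = (G *v (transpose X *v y)) $ i" for y
    by (simp add: c_def inner_range_transpose sym inner_axis' del: transpose_matrix_vector)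
  have c_self: "c \<bullet> c = G $ i $ i"
    by (simp add: c_inner) (simp add: c_def A_mult[symmetric] AGv matrix_vector_mul_component
        flip: transpose_matrix_vector, simp add: inner_axis)
  have c0: "c \<noteq> 0"
  proof
    assume "c = 0"
    then have "A *v (G *v axis i 1) = 0"
      by (simp add: A_mult c_def[symmetric])
    then show False by (simp add: AGv)
  qed
  have xi: "xi X i = sqrt (real CARD('n)) * norm c"
    unfolding xi_def A_def[symmetric] inv'
    by (simp add: real_sqrt_mult norm_eq_sqrt_inner c_self)
  define R where "R = {y \<in> UNIV. \<forall>x\<in>range ((*v) X). orthogonal x y}"
  have subR: "subspace R" by (auto simp: R_def subspace_def orthogonal_clauses)
  obtain B where B: "B \<subseteq> R" "pairwise orthogonal B" "\<And>b. b \<in> B \<Longrightarrow> norm b = 1"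
    "independent B" "card B = dim R" "span B = R"
    using orthonormal_basis_subspace[OF subR] by metis
  have finB: "finite B" using B(4) by (rule independent_imp_finite)
  have "dim R + dim (range ((*v) X)) = dim (UNIV :: (real^'n) set)"
    unfolding R_def
    by (intro dim_subspace_orthogonal_to_vectors linear_subspace_image matrix_vector_mul_linear) auto
  then have card: "card B + CARD('k) = CARD('n)"
    using rank B(5) by (simp add: rank_dim_range)
  have sig: "sigma_hat X (X *v \<theta> + y)
        = sqrt (\<Sum>b\<in>B. (b \<bullet> y)\<^sup>2) / sqrt (real CARD('n) - real CARD('k))" for \<theta> y
  proof -
    define r where "r = X *v \<theta> + y - X *v ls_estimator X (X *v \<theta> + y)"
    have r: "r = y - X *v (G *v (transpose X *v y))"
      by (simp add: r_def ls matrix_vector_right_distrib del: transpose_matrix_vector)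
    have "transpose X *v r = 0"
      unfolding r matrix_vector_mult_diff_distrib A_mult[symmetric] AGv by simp
    then have "r \<in> R"
      unfolding R_def by (auto simp: orthogonal_def inner_range_transpose simp del: transpose_matrix_vector)
    then have exp: "(\<Sum>b\<in>B. (r \<bullet> b) *\<^sub>R b) = r"
      using B by (intro orthonormal_basis_expand finB) auto
    \<comment> \<open>The fitted part of the response is orthogonal to \<open>b\<close>, so only the noise contributes.\<close>
  have rb: "r \<bullet> b = b \<bullet> y" if "b \<in> B" for b
    proof -
      have "(X *v v) \<bullet> b = 0" for v
        using that B(1) by (auto simp: R_def orthogonal_def)
      then show ?thesis by (simp add: r inner_diff_left inner_diff_right inner_commute del: transpose_matrix_vector)
    qed
    have "r \<bullet> r = (\<Sum>b\<in>B. (r \<bullet> b) *\<^sub>R b) \<bullet> r" by (simp add: exp)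
    also have "\<dots> = (\<Sum>b\<in>B. (b \<bullet> y)\<^sup>2)"
      unfolding inner_sum_left by (simp add: rb inner_commute[of _ r] power2_eq_square)
    finally show ?thesis
      by (simp add: sigma_hat_def Let_def r_def[symmetric] real_sqrt_divide)
  qed
  show ?thesis
  proof (rule that[of c B])
    show "orthogonal c b" if "b \<in> B" for b
      using that B(1) by (auto simp: R_def c_def)
    show "ls_estimator X (X *v \<theta> + y) $ i = \<theta> $ i + c \<bullet> y" for \<theta> y
      by (simp add: ls c_inner del: transpose_matrix_vector)
  qed (use c0 xi finB card B sig in auto)
qed

section \<open>Adaptive soft-thresholding and normal integrals\<close>

text \<open>With \<open>c\<close> as the threshold this is \<open>b (1 - c\<^sup>2 / b\<^sup>2)\<^sub>+\<close>, the rule that the adaptive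
  estimator applies to the least squares estimate.\<close>

definition soft :: "real \<Rightarrow> real \<Rightarrow> real" where
  "soft c b = (if \<bar>b\<bar> \<le> c then 0 else b - c\<^sup>2 / b)"

lemma borel_measurable_soft [measurable (raw)]:
  assumes "f \<in> borel_measurable M" "g \<in> borel_measurable M"
  shows "(\<lambda>x. soft (f x) (g x)) \<in> borel_measurable M"
  using assms unfolding soft_def by measurable

lemma soft_scale:
  assumes "r > 0" shows "soft (r * c) (r * b) = r * soft c b"
  using assms by (simp add: soft_def abs_mult right_diff_distrib power2_eq_square)

lemma soft_eq_quotient:
  assumes "c < \<bar>b\<bar>" "c \<ge> 0"
  shows "soft c b = (b\<^sup>2 - c\<^sup>2) / b"
proof -
  have "b \<noteq> 0" using assms by auto
  then show ?thesis using assms by (simp add: soft_def diff_divide_distrib power2_eq_square)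
qed

lemma soft_eq_0_iff:
  assumes "c \<ge> 0"
  shows "soft c b = 0 \<longleftrightarrow> \<bar>b\<bar> \<le> c"
proof (cases "\<bar>b\<bar> \<le> c")
  case False
  then have "c\<^sup>2 < \<bar>b\<bar>\<^sup>2" using assms by (intro power_strict_mono) auto
  then show ?thesis using False assms by (auto simp: soft_eq_quotient)
qed (simp add: soft_def)

text \<open>The bounds are the two roots of \<open>b\<^sup>2 - w b - c\<^sup>2\<close>, the polynomial obtained from
  \<open>b - c\<^sup>2 / b \<le> w\<close> after multiplication by \<open>b\<close>. For \<open>w \<ge> 0\<close> the thresholded region satisfies
  the inequality and the larger root decides; for \<open>w < 0\<close> only \<open>b < - c\<close> can satisfy it, and
  the smaller root decides.\<close>

lemma soft_le_iff:
  assumes c: "c \<ge> 0"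
  shows "soft c b \<le> w \<longleftrightarrow>
    b \<le> (if w \<ge> 0 then w / 2 + sqrt ((w / 2)\<^sup>2 + c\<^sup>2) else w / 2 - sqrt ((w / 2)\<^sup>2 + c\<^sup>2))"
proof -
  \<comment> \<open>The roots are \<open>h - q \<le> 0\<close> and \<open>h + q \<ge> 0\<close>.\<close>
  define h where "h = w / 2"
  then have w: "w = 2 * h" by simp
  define q where "q = sqrt (h\<^sup>2 + c\<^sup>2)"
  have q2: "q\<^sup>2 = h\<^sup>2 + c\<^sup>2" and q0: "q \<ge> 0"
    by (simp_all add: q_def)
  have qc: "c \<le> q"
    by (rule power2_le_imp_le) (simp_all add: q2 q0)
  have qw: "\<bar>h\<bar> \<le> q"
    by (rule power2_le_imp_le) (simp_all add: q2 q0)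
  have fac: "b\<^sup>2 - w * b - c\<^sup>2 = (b - (h + q)) * (b - (h - q))"
    using q2 by (simp add: w algebra_simps power2_eq_square)
  consider (mid) "\<bar>b\<bar> \<le> c" | (pos) "b > c" | (neg) "b < - c" by linarith
  then show ?thesis
    unfolding h_def[symmetric] q_def[symmetric]
  proof cases
    case mid
    have "\<not> b \<le> h - q" if "w < 0"
      using that mid qc w by linarith
    moreover have "b \<le> h + q" if "w \<ge> 0"
      using that mid qc w by linarith
    ultimately show "soft c b \<le> w \<longleftrightarrow> b \<le> (if w \<ge> 0 then h + q else h - q)"
      using mid by (auto simp: soft_def)
  next
    case pos
    then have b: "b > 0" and s: "soft c b = (b\<^sup>2 - c\<^sup>2) / b"
      using c by (auto intro!: soft_eq_quotient)
    have "c\<^sup>2 < b\<^sup>2" using pos c by (intro power_strict_mono) auto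
    then have spos: "soft c b > 0" using b by (simp add: s)
    have "soft c b \<le> w \<longleftrightarrow> b\<^sup>2 - w * b - c\<^sup>2 \<le> 0"
      using b by (auto simp: s pos_divide_le_eq)
    moreover have p: "b - (h - q) > 0" using b qw by linarith
    then have "b\<^sup>2 - w * b - c\<^sup>2 \<le> 0 \<longleftrightarrow> b \<le> h + q"
      unfolding fac by (auto simp: mult_le_0_iff)
    ultimately show "soft c b \<le> w \<longleftrightarrow> b \<le> (if w \<ge> 0 then h + q else h - q)"
      using spos p by (cases "w \<ge> 0") simp_all
  next
    case neg
    then have b: "b < 0" and s: "soft c b = (b\<^sup>2 - c\<^sup>2) / b"
      using c by (auto intro!: soft_eq_quotient)
    have "c\<^sup>2 < (-b)\<^sup>2" using neg c by (intro power_strict_mono) auto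
    then have sneg: "soft c b < 0" using b by (simp add: s divide_pos_neg)
    have "soft c b \<le> w \<longleftrightarrow> b\<^sup>2 - w * b - c\<^sup>2 \<ge> 0"
      using b by (auto simp: s neg_divide_le_eq)
    moreover have p: "b - (h + q) < 0" using b qw by linarith
    then have "b\<^sup>2 - w * b - c\<^sup>2 \<ge> 0 \<longleftrightarrow> b \<le> h - q"
      unfolding fac by (auto simp: zero_le_mult_iff)
    ultimately show "soft c b \<le> w \<longleftrightarrow> b \<le> (if w \<ge> 0 then h + q else h - q)"
      using sneg p by (cases "w \<ge> 0") simp_all
  qed
qed

lemma std_normal_measure_Icc:
  assumes "a \<le> b"
  shows "measure std_normal_distribution {a..b} = std_normal_cdf b - std_normal_cdf a"
proof -
  have "emeasure std_normal_distribution {a} = 0"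
    by (simp add: emeasure_density nn_integral_null_set)
  then have "measure std_normal_distribution {a} = 0" by (simp add: measure_def)
  moreover have eq: "{a..b} = {a} \<union> {a<..b}" using assms by auto
  have "measure std_normal_distribution {a..b}
      = measure std_normal_distribution {a} + measure std_normal_distribution {a<..b}"
    unfolding eq by (rule std_normal.finite_measure_Union) auto
  moreover have "measure std_normal_distribution {a<..b} = std_normal_cdf b - std_normal_cdf a"
    using assms by (cases "a = b") (auto simp: std_normal.cdf_diff_eq)
  ultimately show ?thesis by simp
qed

lemma isCont_normal_density: "isCont (normal_density \<mu> \<sigma>) x" if "\<sigma> > 0"
  using that unfolding normal_density_def by (intro continuous_intros) auto

text \<open>The fundamental theorem of calculus on a compact interval around \<open>x\<close>.\<close>

lemma DERIV_std_normal_cdf: "(std_normal_cdf has_real_derivative std_normal_density x) (at x)"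
proof -
  have cont: "continuous_on {a..b} std_normal_density" for a b :: real
    by (intro continuous_at_imp_continuous_on ballI isCont_normal_density) simp
  have eq: "std_normal_cdf u = std_normal_cdf (x - 1) + integral {x-1..u} std_normal_density"
    if u: "u \<ge> x - 1" for u
  proof -
    have "measure std_normal_distribution {x-1..u} = (LINT t|std_normal_distribution. indicator {x-1..u} t)"
      by simp
    also have "\<dots> = (LBINT t:{x-1..u}. std_normal_density t)"
      by (subst integral_density) (auto simp: set_lebesgue_integral_def mult.commute)
    also have "\<dots> = integral {x-1..u} std_normal_density"
      by (intro set_borel_integral_eq_integral borel_integrable_atLeastAtMost' cont)
    finally show ?thesis using std_normal_measure_Icc[OF u] by simp
  qed
  have "((\<lambda>u. integral {x-1..u} std_normal_density) has_real_derivative std_normal_density x)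
      (at x within {x-1..x+1})"
    by (rule integral_has_real_derivative[OF cont]) auto
  then have "((\<lambda>u. integral {x-1..u} std_normal_density) has_real_derivative std_normal_density x) (at x)"
    by (simp add: at_within_Icc_at)
  from DERIV_add[OF DERIV_const[of "std_normal_cdf (x - 1)"] this]
  have "((\<lambda>u. std_normal_cdf (x - 1) + integral {x-1..u} std_normal_density)
      has_real_derivative std_normal_density x) (at x)"
    unfolding add_0_left .
  then show ?thesis
  proof (rule has_field_derivative_transform_within_open)
    show "open {x-1<..}" "x \<in> {x-1<..}" by auto
    show "std_normal_cdf (x - 1) + integral {x-1..u} std_normal_density = std_normal_cdf u"
      if "u \<in> {x-1<..}" for u
      using that by (intro eq[symmetric]) simp
  qed
qed

text \<open>The fundamental theorem for nonnegative functions on possibly unbounded intervals, where the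
  boundary values of the antiderivative are limits.\<close>

lemma nn_integral_FTC_einterval:
  fixes f F :: "real \<Rightarrow> real" and a b :: ereal
  assumes "a < b"
    and F: "\<And>x. a < ereal x \<Longrightarrow> ereal x < b \<Longrightarrow> DERIV F x :> f x"
    and f: "\<And>x. a < ereal x \<Longrightarrow> ereal x < b \<Longrightarrow> isCont f x"
    and nn: "\<And>x. 0 \<le> f x"
    and A: "((F \<circ> real_of_ereal) \<longlongrightarrow> A) (at_right a)"
    and B: "((F \<circ> real_of_ereal) \<longlongrightarrow> B) (at_left b)"
  shows "(\<integral>\<^sup>+x\<in>einterval a b. ennreal (f x) \<partial>lborel) = ennreal (B - A)"
proof -
  have int: "set_integrable lborel (einterval a b) f"
    by (rule interval_integral_FTC_nonneg(1)[OF assms(1) F f _ A B]) (use nn in auto)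
  have eq: "(LBINT x=a..b. f x) = B - A"
    by (rule interval_integral_FTC_nonneg(2)[OF assms(1) F f _ A B]) (use nn in auto)
  have "(\<integral>\<^sup>+x\<in>einterval a b. ennreal (f x) \<partial>lborel)
      = (\<integral>\<^sup>+x. ennreal (indicator (einterval a b) x *\<^sub>R f x) \<partial>lborel)"
    by (intro nn_integral_cong) (auto simp: indicator_def)
  also have "\<dots> = ennreal (LBINT x:einterval a b. f x)"
    using int nn unfolding set_integrable_def set_lebesgue_integral_def
    by (intro nn_integral_eq_integral) auto
  finally show ?thesis
    using eq assms(1) by (simp add: interval_lebesgue_integral_le_eq)
qed

section \<open>The law of the scaled error for a known scale\<close>

text \<open>The scalar parameters that remain once the model is reduced to a single normal variable:
  \<open>b\<close> is the coefficient that is estimated, and \<open>\<xi> / sqrt n\<close> is the standard deviation of its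
  least squares estimate in units of \<open>\<sigma>\<close>.\<close>

locale thresholded_normal =
  fixes n :: nat and \<xi> \<alpha> b \<sigma> :: real
  assumes n: "n > 0" and \<xi>: "\<xi> > 0" and \<alpha>: "\<alpha> > 0" and \<sigma>: "\<sigma> > 0"
begin

abbreviation "Z1 \<equiv> z1 n \<xi> \<alpha> b \<sigma>"
abbreviation "Z2 \<equiv> z2 n \<xi> \<alpha> b \<sigma>"
abbreviation "t \<equiv> t_fun \<xi> \<alpha> b \<sigma>"

text \<open>The scaled estimation error as a function of the standardised least squares error \<open>w\<close>, when
  \<open>\<sigma>_hat \<eta>\<close> equals \<open>\<sigma> y\<close>.\<close>

definition err :: "real \<Rightarrow> real \<Rightarrow> real" where
  "err y w = \<alpha> * (soft (\<xi> * y) (b / \<sigma> + \<xi> / sqrt n * w) - b / \<sigma>)"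

lemma borel_measurable_err [measurable (raw)]:
  assumes "f \<in> borel_measurable M" "g \<in> borel_measurable M"
  shows "(\<lambda>x. err (f x) (g x)) \<in> borel_measurable M"
  using assms unfolding err_def by measurable

lemma sqrt_rescale:
  "sqrt n * sqrt ((1/2 * inverse \<xi> * v)\<^sup>2 + y\<^sup>2) = sqrt n / \<xi> * sqrt ((v / 2)\<^sup>2 + (\<xi> * y)\<^sup>2)"
proof -
  have "(1/2 * inverse \<xi> * v)\<^sup>2 + y\<^sup>2 = ((v / 2)\<^sup>2 + (\<xi> * y)\<^sup>2) / \<xi>\<^sup>2"
    using \<xi> by (simp add: field_simps power2_eq_square)
  then show ?thesis using \<xi> by (simp add: real_sqrt_divide)
qed

text \<open>In this form \<open>z\<^sup>(\<^sup>1\<^sup>)\<close> and \<open>z\<^sup>(\<^sup>2\<^sup>)\<close> are the two roots of \<open>soft_le_iff\<close>, with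
  \<open>w = x / \<alpha> + b / \<sigma>\<close> and \<open>c = \<xi> y\<close>, after the affine change of variable that turns the
  estimate into a standard normal variable.\<close>

lemma Z_eq:
  fixes x y :: real
  defines "v \<equiv> x / \<alpha> + b / \<sigma>"
  shows "Z1 x y = sqrt n / \<xi> * ((v / 2 - sqrt ((v / 2)\<^sup>2 + (\<xi> * y)\<^sup>2)) - b / \<sigma>)"
    and "Z2 x y = sqrt n / \<xi> * ((v / 2 + sqrt ((v / 2)\<^sup>2 + (\<xi> * y)\<^sup>2)) - b / \<sigma>)"
proof -
  have "1/2 * sqrt n * inverse \<xi> * (x / \<alpha> - b / \<sigma>) = sqrt n / \<xi> * (v / 2 - b / \<sigma>)"
    by (simp add: v_def field_simps)
  then show "Z1 x y = sqrt n / \<xi> * ((v / 2 - sqrt ((v / 2)\<^sup>2 + (\<xi> * y)\<^sup>2)) - b / \<sigma>)"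
    and "Z2 x y = sqrt n / \<xi> * ((v / 2 + sqrt ((v / 2)\<^sup>2 + (\<xi> * y)\<^sup>2)) - b / \<sigma>)"
    unfolding z1_def z2_def v_def[symmetric] sqrt_rescale by (simp_all add: algebra_simps)
qed

lemma affine_le_iff: "b / \<sigma> + \<xi> / sqrt n * w \<le> r \<longleftrightarrow> w \<le> sqrt n / \<xi> * (r - b / \<sigma>)"
  and affine_ge_iff: "r \<le> b / \<sigma> + \<xi> / sqrt n * w \<longleftrightarrow> sqrt n / \<xi> * (r - b / \<sigma>) \<le> w"
proof -
  have p: "\<xi> / sqrt n > 0" using n \<xi> by simp
  have *: "sqrt n / \<xi> * q = q / (\<xi> / sqrt n)" for q by simp
  show "b / \<sigma> + \<xi> / sqrt n * w \<le> r \<longleftrightarrow> w \<le> sqrt n / \<xi> * (r - b / \<sigma>)"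
    unfolding * pos_le_divide_eq[OF p] by (auto simp: mult.commute)
  show "r \<le> b / \<sigma> + \<xi> / sqrt n * w \<longleftrightarrow> sqrt n / \<xi> * (r - b / \<sigma>) \<le> w"
    unfolding * pos_divide_le_eq[OF p] by (auto simp: mult.commute)
qed

lemma err_le_iff:
  assumes y: "y \<ge> 0"
  shows "err y w \<le> x \<longleftrightarrow> w \<le> (if x / \<alpha> + b / \<sigma> \<ge> 0 then Z2 x y else Z1 x y)"
proof -
  have "err y w \<le> x \<longleftrightarrow> soft (\<xi> * y) (b / \<sigma> + \<xi> / sqrt n * w) - b / \<sigma> \<le> x / \<alpha>"
    unfolding err_def pos_le_divide_eq[OF \<alpha>] by (simp only: mult.commute)
  also have "\<dots> \<longleftrightarrow> soft (\<xi> * y) (b / \<sigma> + \<xi> / sqrt n * w) \<le> x / \<alpha> + b / \<sigma>"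
    by linarith
  also have "\<dots> \<longleftrightarrow> w \<le> (if x / \<alpha> + b / \<sigma> \<ge> 0 then Z2 x y else Z1 x y)"
    using \<xi> y by (cases "x / \<alpha> + b / \<sigma> \<ge> 0"; subst soft_le_iff)
      (simp_all only: affine_le_iff Z_eq mult_nonneg_nonneg less_imp_le if_True if_False)
  finally show ?thesis .
qed

lemma err_eq_atom_iff:
  assumes y: "y \<ge> 0"
  shows "err y w = - \<alpha> * b / \<sigma> \<longleftrightarrow>
    w \<in> {sqrt n * (- b / (\<sigma> * \<xi>) - y) .. sqrt n * (- b / (\<sigma> * \<xi>) + y)}"
proof -
  have "err y w = - \<alpha> * b / \<sigma> \<longleftrightarrow> soft (\<xi> * y) (b / \<sigma> + \<xi> / sqrt n * w) = 0"
    using \<alpha> by (simp add: err_def right_diff_distrib)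
  also have "\<dots> \<longleftrightarrow> - (\<xi> * y) \<le> b / \<sigma> + \<xi> / sqrt n * w \<and> b / \<sigma> + \<xi> / sqrt n * w \<le> \<xi> * y"
    using \<xi> y by (subst soft_eq_0_iff) (simp_all only: abs_le_iff mult_nonneg_nonneg less_imp_le, linarith)
  also have "\<dots> \<longleftrightarrow> sqrt n / \<xi> * (- (\<xi> * y) - b / \<sigma>) \<le> w \<and> w \<le> sqrt n / \<xi> * (\<xi> * y - b / \<sigma>)"
    by (simp only: affine_le_iff affine_ge_iff)
  also have "sqrt n / \<xi> * (- (\<xi> * y) - b / \<sigma>) = sqrt n * (- b / (\<sigma> * \<xi>) - y)"
    using \<xi> \<sigma> by (simp add: field_simps)
  also have "sqrt n / \<xi> * (\<xi> * y - b / \<sigma>) = sqrt n * (- b / (\<sigma> * \<xi>) + y)"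
    using \<xi> \<sigma> by (simp add: field_simps)
  finally show ?thesis by simp
qed

text \<open>At the atom the two functions bound the interval on which the estimate is thresholded to 0,
  so the atom is exactly the jump from the \<open>z\<^sup>(\<^sup>1\<^sup>)\<close>-branch to the \<open>z\<^sup>(\<^sup>2\<^sup>)\<close>-branch.\<close>

lemma Z_atom:
  assumes y: "y \<ge> 0"
  shows "Z1 (- \<alpha> * b / \<sigma>) y = sqrt n * (- b / (\<sigma> * \<xi>) - y)"
    and "Z2 (- \<alpha> * b / \<sigma>) y = sqrt n * (- b / (\<sigma> * \<xi>) + y)"
proof -
  have v: "(- \<alpha> * b / \<sigma>) / \<alpha> + b / \<sigma> = 0" using \<alpha> by simp
  show "Z1 (- \<alpha> * b / \<sigma>) y = sqrt n * (- b / (\<sigma> * \<xi>) - y)"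
    and "Z2 (- \<alpha> * b / \<sigma>) y = sqrt n * (- b / (\<sigma> * \<xi>) + y)"
    unfolding Z_eq v using \<xi> \<sigma> y by (simp_all add: right_diff_distrib distrib_left)
qed

lemma atom_side:
  "x / \<alpha> + b / \<sigma> > 0 \<longleftrightarrow> x > - \<alpha> * b / \<sigma>"
  "x / \<alpha> + b / \<sigma> < 0 \<longleftrightarrow> x < - \<alpha> * b / \<sigma>"
  "x / \<alpha> + b / \<sigma> \<ge> 0 \<longleftrightarrow> x \<ge> - \<alpha> * b / \<sigma>"
proof -
  have "x = \<alpha> * (x / \<alpha>)" "- \<alpha> * b / \<sigma> = \<alpha> * (- (b / \<sigma>))" using \<alpha> by simp_all
  then have "x > - \<alpha> * b / \<sigma> \<longleftrightarrow> x / \<alpha> > - (b / \<sigma>)" "x < - \<alpha> * b / \<sigma> \<longleftrightarrow> x / \<alpha> < - (b / \<sigma>)"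
    using \<alpha> by (metis mult_less_cancel_left_pos)+
  then show "x / \<alpha> + b / \<sigma> > 0 \<longleftrightarrow> x > - \<alpha> * b / \<sigma>"
    "x / \<alpha> + b / \<sigma> < 0 \<longleftrightarrow> x < - \<alpha> * b / \<sigma>"
    "x / \<alpha> + b / \<sigma> \<ge> 0 \<longleftrightarrow> x \<ge> - \<alpha> * b / \<sigma>"
    by linarith+
qed

lemma t_bounds: "\<bar>t x y\<bar> \<le> 1"
proof -
  have "\<bar>p / sqrt (p\<^sup>2 + y\<^sup>2)\<bar> \<le> 1" for p :: real
  proof -
    have "\<bar>p\<bar> \<le> sqrt (p\<^sup>2 + y\<^sup>2)" by (rule real_sqrt_ge_abs1)
    moreover have "p\<^sup>2 + y\<^sup>2 > 0" if "p \<noteq> 0" using that by (simp add: add_pos_nonneg)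
    ultimately show ?thesis by (cases "p = 0") (auto simp: divide_le_eq_1)
  qed
  then show ?thesis unfolding t_fun_def .
qed

text \<open>The factors \<open>1 \<plusminus> t\<close> of the density arise here: up to a constant, \<open>t\<close> is the derivative of the
  square root in \<open>z\<^sup>(\<^sup>1\<^sup>)\<close> and \<open>z\<^sup>(\<^sup>2\<^sup>)\<close>.\<close>

lemma DERIV_Z:
  assumes y: "y > 0"
  shows "((\<lambda>x. Z1 x y) has_real_derivative 1/2 * sqrt n / (\<alpha> * \<xi>) * (1 - t x y)) (at x)"
    and "((\<lambda>x. Z2 x y) has_real_derivative 1/2 * sqrt n / (\<alpha> * \<xi>) * (1 + t x y)) (at x)"
proof -
  define A where "A = (\<lambda>x. 1/2 * inverse \<xi> * (x / \<alpha> + b / \<sigma>))"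
  define R where "R = (\<lambda>x. sqrt ((A x)\<^sup>2 + y\<^sup>2))"
  have pos: "(A x)\<^sup>2 + y\<^sup>2 > 0" using y by (simp add: add_nonneg_pos)
  have A': "(A has_real_derivative 1/2 * inverse \<xi> / \<alpha>) (at x)"
    unfolding A_def using \<alpha> by (auto intro!: derivative_eq_intros)
  have "((\<lambda>x. (A x)\<^sup>2 + y\<^sup>2) has_real_derivative 2 * A x * (1/2 * inverse \<xi> / \<alpha>)) (at x)"
    by (auto intro!: derivative_eq_intros A')
  note sq' = this
  have t_eq: "t x y = A x / sqrt ((A x)\<^sup>2 + y\<^sup>2)"
    by (simp add: t_fun_def A_def)
  from DERIV_chain2[OF DERIV_real_sqrt[OF pos] sq']
  have R': "(R has_real_derivative 1/2 * inverse \<xi> / \<alpha> * t x y) (at x)"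
    unfolding R_def by (rule DERIV_cong) (simp add: t_eq field_simps)
  have L': "((\<lambda>x. 1/2 * sqrt n * inverse \<xi> * (x / \<alpha> - b / \<sigma>)) has_real_derivative
      1/2 * sqrt n * inverse \<xi> / \<alpha>) (at x)"
    using \<alpha> by (auto intro!: derivative_eq_intros)
  show "((\<lambda>x. Z1 x y) has_real_derivative 1/2 * sqrt n / (\<alpha> * \<xi>) * (1 - t x y)) (at x)"
    using DERIV_diff[OF L' DERIV_cmult[OF R', of "sqrt n"]]
    unfolding z1_def R_def A_def by (rule DERIV_cong) (use \<alpha> \<xi> in \<open>simp add: field_simps\<close>)
  show "((\<lambda>x. Z2 x y) has_real_derivative 1/2 * sqrt n / (\<alpha> * \<xi>) * (1 + t x y)) (at x)"
    using DERIV_add[OF L' DERIV_cmult[OF R', of "sqrt n"]]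
    unfolding z2_def R_def A_def by (rule DERIV_cong) (use \<alpha> \<xi> in \<open>simp add: field_simps\<close>)
qed

lemma isCont_t: "y > 0 \<Longrightarrow> isCont (\<lambda>x. t x y) x"
proof -
  assume "y > 0"
  then have "(1/2 * inverse \<xi> * (x / \<alpha> + b / \<sigma>))\<^sup>2 + y\<^sup>2 > 0" by (simp add: add_nonneg_pos)
  then show ?thesis
    unfolding t_fun_def using \<alpha> \<sigma> by (intro continuous_intros) auto
qed

lemma Z_linear_part:
  "1/2 * sqrt n * inverse \<xi> * (x / \<alpha> - b / \<sigma>)
    = - (1/2 * sqrt n * inverse \<xi> * (b / \<sigma>)) + 1/2 * sqrt n * inverse \<xi> / \<alpha> * x"
  and Z_slope_pos: "1/2 * sqrt n * inverse \<xi> / \<alpha> > 0"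
  using n \<xi> \<alpha> by (simp_all add: right_diff_distrib)

lemma Z1_at_bot: "filterlim (\<lambda>x. Z1 x y) at_bot at_bot"
proof (rule filterlim_at_bot_mono)
  show "LIM x at_bot. 1/2 * sqrt n * inverse \<xi> * (x / \<alpha> - b / \<sigma>) :> at_bot"
    unfolding Z_linear_part filterlim_tendsto_add_at_bot_iff[OF tendsto_const]
    by (rule filterlim_tendsto_pos_mult_at_bot[OF tendsto_const Z_slope_pos filterlim_ident])
qed (auto intro!: always_eventually simp: z1_def)

lemma Z2_at_top: "filterlim (\<lambda>x. Z2 x y) at_top at_top"
proof (rule filterlim_at_top_mono)
  show "LIM x at_top. 1/2 * sqrt n * inverse \<xi> * (x / \<alpha> - b / \<sigma>) :> at_top"
    unfolding Z_linear_part
    by (rule filterlim_tendsto_add_at_top[OF tendsto_const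
          filterlim_tendsto_pos_mult_at_top[OF tendsto_const Z_slope_pos filterlim_ident]])
qed (auto intro!: always_eventually simp: z2_def)

definition atom :: "real \<Rightarrow> real" where
  "atom y = std_normal_cdf (sqrt n * (- b / (\<sigma> * \<xi>) + y))
          - std_normal_cdf (sqrt n * (- b / (\<sigma> * \<xi>) - y))"

text \<open>The derivatives of the conditional cdf on the two sides of the atom, and the density
  composed of them.\<close>

definition dens_below :: "real \<Rightarrow> real \<Rightarrow> real" where
  "dens_below y x = 1/2 * sqrt n / (\<alpha> * \<xi>) * (std_normal_density (Z1 x y) * (1 - t x y))"

definition dens_above :: "real \<Rightarrow> real \<Rightarrow> real" where
  "dens_above y x = 1/2 * sqrt n / (\<alpha> * \<xi>) * (std_normal_density (Z2 x y) * (1 + t x y))"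

definition dens :: "real \<Rightarrow> real \<Rightarrow> real" where
  "dens y x = (if x < - \<alpha> * b / \<sigma> then dens_below y x else if x > - \<alpha> * b / \<sigma> then dens_above y x else 0)"

lemma dens_sides_nonneg: "0 \<le> dens_below y x" "0 \<le> dens_above y x"
  using t_bounds[of x y] \<alpha> \<xi> unfolding dens_below_def dens_above_def abs_le_iff
  by (intro mult_nonneg_nonneg divide_nonneg_nonneg; simp)+

lemma borel_measurable_Z [measurable (raw)]:
  assumes [measurable]: "f \<in> borel_measurable M" "g \<in> borel_measurable M"
  shows "(\<lambda>x. Z1 (f x) (g x)) \<in> borel_measurable M" "(\<lambda>x. Z2 (f x) (g x)) \<in> borel_measurable M"
    "(\<lambda>x. t (f x) (g x)) \<in> borel_measurable M"
  unfolding z1_def z2_def t_fun_def by measurable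

lemma borel_measurable_dens [measurable (raw)]:
  assumes [measurable]: "f \<in> borel_measurable M" "g \<in> borel_measurable M"
  shows "(\<lambda>x. dens_below (f x) (g x)) \<in> borel_measurable M" "(\<lambda>x. dens_above (f x) (g x)) \<in> borel_measurable M"
    "(\<lambda>x. dens (f x) (g x)) \<in> borel_measurable M"
  unfolding dens_def dens_below_def dens_above_def by measurable

lemma DERIV_cdf_Z:
  assumes y: "y > 0"
  shows "((\<lambda>x. std_normal_cdf (Z1 x y)) has_real_derivative dens_below y x) (at x)"
    and "((\<lambda>x. std_normal_cdf (Z2 x y)) has_real_derivative dens_above y x) (at x)"
  using DERIV_chain2[OF DERIV_std_normal_cdf DERIV_Z(1)[OF y]]
    DERIV_chain2[OF DERIV_std_normal_cdf DERIV_Z(2)[OF y]]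
  by (simp_all add: dens_below_def dens_above_def ac_simps)

lemma isCont_dens_sides:
  assumes y: "y > 0"
  shows "isCont (dens_below y) x" "isCont (dens_above y) x"
  unfolding dens_below_def dens_above_def
  by (intro continuous_intros isCont_t[OF y] isCont_o2[OF DERIV_isCont[OF DERIV_Z(1)[OF y]]]
      isCont_o2[OF DERIV_isCont[OF DERIV_Z(2)[OF y]]] isCont_normal_density; simp)+

lemma nn_integral_dens_below:
  assumes y: "y > 0"
  shows "(\<integral>\<^sup>+u\<in>{..<x}. ennreal (dens_below y u) \<partial>lborel) = ennreal (std_normal_cdf (Z1 x y))"
proof -
  have "(\<integral>\<^sup>+u\<in>einterval (-\<infinity>) (ereal x). ennreal (dens_below y u) \<partial>lborel)
      = ennreal (std_normal_cdf (Z1 x y) - 0)"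
  proof (rule nn_integral_FTC_einterval[where F = "\<lambda>x. std_normal_cdf (Z1 x y)"])
    show "(((\<lambda>x. std_normal_cdf (Z1 x y)) \<circ> real_of_ereal) \<longlongrightarrow> 0) (at_right (-\<infinity>))"
      unfolding ereal_tendsto_simps1 by (rule filterlim_compose[OF std_normal.cdf_lim_at_bot Z1_at_bot])
    show "(((\<lambda>x. std_normal_cdf (Z1 x y)) \<circ> real_of_ereal) \<longlongrightarrow> std_normal_cdf (Z1 x y)) (at_left (ereal x))"
      unfolding ereal_tendsto_simps1
      using DERIV_isCont[OF DERIV_cdf_Z(1)[OF y]] by (simp add: isCont_def filterlim_at_split)
  qed (auto intro: DERIV_cdf_Z[OF y] isCont_dens_sides[OF y] dens_sides_nonneg)
  then show ?thesis by simp
qed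

lemma nn_integral_dens_above:
  assumes y: "y > 0"
  shows "a < x \<Longrightarrow> (\<integral>\<^sup>+u\<in>{a<..<x}. ennreal (dens_above y u) \<partial>lborel)
        = ennreal (std_normal_cdf (Z2 x y) - std_normal_cdf (Z2 a y))"
    and "(\<integral>\<^sup>+u\<in>{a<..}. ennreal (dens_above y u) \<partial>lborel) = ennreal (1 - std_normal_cdf (Z2 a y))"
proof -
  have cont: "isCont (\<lambda>x. std_normal_cdf (Z2 x y)) x" for x
    using DERIV_isCont[OF DERIV_cdf_Z(2)[OF y]] .
  have lower: "(((\<lambda>x. std_normal_cdf (Z2 x y)) \<circ> real_of_ereal) \<longlongrightarrow> std_normal_cdf (Z2 a y)) (at_right (ereal a))"
    unfolding ereal_tendsto_simps1 using cont by (simp add: isCont_def filterlim_at_split)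
  show "(\<integral>\<^sup>+u\<in>{a<..<x}. ennreal (dens_above y u) \<partial>lborel)
        = ennreal (std_normal_cdf (Z2 x y) - std_normal_cdf (Z2 a y))" if "a < x"
  proof -
    have "(\<integral>\<^sup>+u\<in>einterval (ereal a) (ereal x). ennreal (dens_above y u) \<partial>lborel)
        = ennreal (std_normal_cdf (Z2 x y) - std_normal_cdf (Z2 a y))"
    proof (rule nn_integral_FTC_einterval[where F = "\<lambda>x. std_normal_cdf (Z2 x y)"])
      show "(((\<lambda>x. std_normal_cdf (Z2 x y)) \<circ> real_of_ereal) \<longlongrightarrow> std_normal_cdf (Z2 x y)) (at_left (ereal x))"
        unfolding ereal_tendsto_simps1 using cont by (simp add: isCont_def filterlim_at_split)
    qed (use that in \<open>auto intro: DERIV_cdf_Z[OF y] isCont_dens_sides[OF y] dens_sides_nonneg lower\<close>)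
    then show ?thesis by simp
  qed
  have "(\<integral>\<^sup>+u\<in>einterval (ereal a) \<infinity>. ennreal (dens_above y u) \<partial>lborel)
      = ennreal (1 - std_normal_cdf (Z2 a y))"
  proof (rule nn_integral_FTC_einterval[where F = "\<lambda>x. std_normal_cdf (Z2 x y)"])
    show "(((\<lambda>x. std_normal_cdf (Z2 x y)) \<circ> real_of_ereal) \<longlongrightarrow> 1) (at_left \<infinity>)"
      unfolding ereal_tendsto_simps1 by (rule filterlim_compose[OF std_normal.cdf_lim_at_top_prob Z2_at_top])
  qed (auto intro: DERIV_cdf_Z[OF y] isCont_dens_sides[OF y] dens_sides_nonneg lower)
  then show "(\<integral>\<^sup>+u\<in>{a<..}. ennreal (dens_above y u) \<partial>lborel) = ennreal (1 - std_normal_cdf (Z2 a y))"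
    by simp
qed

lemma emeasure_err_atMost:
  assumes "y \<ge> 0"
  shows "emeasure (distr std_normal_distribution borel (err y)) {..x}
    = ennreal (std_normal_cdf (if x / \<alpha> + b / \<sigma> \<ge> 0 then Z2 x y else Z1 x y))"
proof -
  have "err y -` {..x} = {..(if x / \<alpha> + b / \<sigma> \<ge> 0 then Z2 x y else Z1 x y)}"
    using err_le_iff[OF assms] by auto
  then show ?thesis
    by (subst emeasure_distr) (auto simp: cdf_def std_normal.emeasure_eq_measure)
qed

lemma emeasure_err_atom:
  assumes "y \<ge> 0"
  shows "emeasure (distr std_normal_distribution borel (err y)) {- \<alpha> * b / \<sigma>} = ennreal (atom y)"
proof -
  have "err y -` {- \<alpha> * b / \<sigma>} = {sqrt n * (- b / (\<sigma> * \<xi>) - y) .. sqrt n * (- b / (\<sigma> * \<xi>) + y)}"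
    using err_eq_atom_iff[OF assms] by auto
  then have "emeasure (distr std_normal_distribution borel (err y)) {- \<alpha> * b / \<sigma>}
    = ennreal (measure std_normal_distribution
       {sqrt n * (- b / (\<sigma> * \<xi>) - y) .. sqrt n * (- b / (\<sigma> * \<xi>) + y)})"
    by (subst emeasure_distr) (auto simp: std_normal.emeasure_eq_measure)
  also have "\<dots> = ennreal (atom y)"
    unfolding atom_def using assms by (subst std_normal_measure_Icc) (auto intro!: mult_left_mono)
  finally show ?thesis .
qed

lemma atom_bounds: "y \<ge> 0 \<Longrightarrow> 0 \<le> atom y" "atom y \<le> 1"
proof -
  show "y \<ge> 0 \<Longrightarrow> 0 \<le> atom y"
    unfolding atom_def by (auto intro!: std_normal.cdf_nondecreasing mult_left_mono)
  show "atom y \<le> 1"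
    using std_normal.cdf_bounded_prob[of "sqrt n * (- b / (\<sigma> * \<xi>) + y)"]
      std_normal.cdf_nonneg[of "sqrt n * (- b / (\<sigma> * \<xi>) - y)"]
    unfolding atom_def by linarith
qed

text \<open>Below the atom the density integrates to the \<open>z\<^sup>(\<^sup>1\<^sup>)\<close>-branch of the cdf. Above it, the
  \<open>z\<^sup>(\<^sup>2\<^sup>)\<close>-branch is lowered by the mass of the atom.\<close>

lemma emeasure_density_dens:
  assumes y: "y > 0"
  defines "M2 \<equiv> density lborel (\<lambda>x. ennreal (dens y x))"
  shows "x < - \<alpha> * b / \<sigma> \<Longrightarrow> emeasure M2 {..x} = ennreal (std_normal_cdf (Z1 x y))"
    and "x \<ge> - \<alpha> * b / \<sigma> \<Longrightarrow> emeasure M2 {..x} = ennreal (std_normal_cdf (Z2 x y) - atom y)"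
    and "emeasure M2 UNIV < \<infinity>"
proof -
  let ?a = "- \<alpha> * b / \<sigma>"
  have neq: "AE u in lborel. u \<noteq> z" for z :: real by (rule AE_lborel_singleton)
  show "emeasure M2 {..x} = ennreal (std_normal_cdf (Z1 x y))" if "x < ?a"
  proof -
    have "emeasure M2 {..x} = (\<integral>\<^sup>+u\<in>{..x}. ennreal (dens y u) \<partial>lborel)"
      unfolding M2_def by (rule emeasure_density) auto
    also have "\<dots> = (\<integral>\<^sup>+u\<in>{..<x}. ennreal (dens_below y u) \<partial>lborel)"
      using neq[of x] that
      by (intro nn_integral_cong_AE) (auto elim!: eventually_mono simp: indicator_def dens_def)
    finally show ?thesis by (simp add: nn_integral_dens_below[OF y])
  qed
  \<comment> \<open>The null sets that are ignored here are the atom and the right end point of \<open>{..x}\<close>.\<close>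
  have split: "emeasure M2 S = ennreal (std_normal_cdf (Z1 ?a y)) + (\<integral>\<^sup>+u\<in>S'. ennreal (dens_above y u) \<partial>lborel)"
    if S: "S \<in> sets borel" "S' \<in> sets borel" "AE u in lborel. u \<in> S \<longleftrightarrow> u < ?a \<or> u \<in> S'"
      "S' \<subseteq> {?a<..}" for S S'
  proof -
    have "emeasure M2 S = (\<integral>\<^sup>+u\<in>S. ennreal (dens y u) \<partial>lborel)"
      unfolding M2_def using S by (intro emeasure_density) auto
    also have "\<dots> = (\<integral>\<^sup>+u. (ennreal (dens_below y u) * indicator {..<?a} u
        + ennreal (dens_above y u) * indicator S' u) \<partial>lborel)"
      using S(3,4) by (intro nn_integral_cong_AE)
        (auto elim!: eventually_mono simp: indicator_def dens_def)
    also have "\<dots> = ennreal (std_normal_cdf (Z1 ?a y)) + (\<integral>\<^sup>+u\<in>S'. ennreal (dens_above y u) \<partial>lborel)"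
      using S by (subst nn_integral_add) (auto simp: nn_integral_dens_below[OF y])
    finally show ?thesis .
  qed
  have at: "atom y = std_normal_cdf (Z2 ?a y) - std_normal_cdf (Z1 ?a y)"
    using y by (simp only: atom_def Z_atom less_imp_le)
  show "emeasure M2 {..x} = ennreal (std_normal_cdf (Z2 x y) - atom y)" if "x \<ge> ?a"
  proof (cases "x = ?a")
    case True
    have "emeasure M2 {..x} = ennreal (std_normal_cdf (Z1 ?a y))
        + (\<integral>\<^sup>+u\<in>{}. ennreal (dens_above y u) \<partial>lborel)"
      using neq[of ?a] True by (intro split) (auto elim!: eventually_mono)
    then show ?thesis by (simp add: at True)
  next
    case False
    then have x: "x > ?a" using that by simp
    have "emeasure M2 {..x} = ennreal (std_normal_cdf (Z1 ?a y))
        + (\<integral>\<^sup>+u\<in>{?a<..<x}. ennreal (dens_above y u) \<partial>lborel)"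
      using neq[of ?a] neq[of x] x by (intro split) auto
    also have "\<dots> = ennreal (std_normal_cdf (Z1 ?a y) + (std_normal_cdf (Z2 x y) - std_normal_cdf (Z2 ?a y)))"
    proof -
      have "Z2 ?a y \<le> Z2 x y"
      proof (rule DERIV_nonneg_imp_nondecreasing[OF less_imp_le[OF x]], intro exI conjI)
        fix u
        show "((\<lambda>x. Z2 x y) has_real_derivative 1/2 * sqrt n / (\<alpha> * \<xi>) * (1 + t u y)) (at u)"
          by (rule DERIV_Z(2)[OF y])
        have "0 \<le> 1 + t u y" using t_bounds[of u y] by linarith
        then show "0 \<le> 1/2 * sqrt n / (\<alpha> * \<xi>) * (1 + t u y)"
          using \<alpha> \<xi> by simp
      qed
      then show ?thesis
        using x by (simp add: nn_integral_dens_above[OF y] std_normal.cdf_nonneg std_normal.cdf_nondecreasing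
          del: ennreal_plus flip: ennreal_plus)
    qed
    finally show ?thesis by (simp add: at algebra_simps)
  qed
  have "emeasure M2 UNIV = ennreal (std_normal_cdf (Z1 ?a y)) + (\<integral>\<^sup>+u\<in>{?a<..}. ennreal (dens_above y u) \<partial>lborel)"
    using neq[of ?a] by (intro split) (auto elim!: eventually_mono)
  then show "emeasure M2 UNIV < \<infinity>"
    by (simp add: nn_integral_dens_above[OF y])
qed

text \<open>After removal of the atom, both sides are finite measures with the same cdf.\<close>

lemma emeasure_err:
  assumes y: "y > 0" and [measurable]: "A \<in> sets borel"
  shows "emeasure (distr std_normal_distribution borel (err y)) A
    = ennreal (atom y) * indicator A (- \<alpha> * b / \<sigma>) + (\<integral>\<^sup>+x\<in>A. ennreal (dens y x) \<partial>lborel)"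
proof -
  let ?a = "- \<alpha> * b / \<sigma>"
  define K where "K = distr std_normal_distribution borel (err y)"
  have K: "finite_measure K"
    unfolding K_def by (intro prob_space.finite_measure std_normal.prob_space_distr) measurable
  note K_finite = finite_measure.emeasure_finite[OF K]
  have [measurable_cong, simp]: "sets K = sets borel" by (simp add: K_def)
  define M1 where "M1 = density K (indicator (- {?a}))"
  define M2 where "M2 = density lborel (\<lambda>x. ennreal (dens y x))"
  have M1: "emeasure M1 S = emeasure K (S - {?a})" if "S \<in> sets borel" for S
    unfolding M1_def using that
    by (subst emeasure_density) (auto simp: nn_integral_indicator[symmetric] indicator_def
        simp del: nn_integral_indicator intro!: nn_integral_cong)
  have "M1 = M2"
  proof (rule cdf_unique')
    show "finite_borel_measure M1"
    proof (intro finite_borel_measure.intro finite_measureI finite_borel_measure_axioms.intro)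
      have "space M1 = UNIV" by (simp add: M1_def K_def)
      then show "emeasure M1 (space M1) \<noteq> \<infinity>" by (simp add: M1 K_finite)
    qed (simp add: M1_def)
    show "finite_borel_measure M2"
    proof (intro finite_borel_measure.intro finite_measureI finite_borel_measure_axioms.intro)
      show "emeasure M2 (space M2) \<noteq> \<infinity>"
        using emeasure_density_dens(3)[OF y] by (simp add: M2_def)
    qed (simp add: M2_def)
    show "cdf M1 = cdf M2"
    proof
      fix x
      have "emeasure M1 {..x} = emeasure M2 {..x}"
      proof (cases "x < ?a")
        case True
        then have "{..x} - {?a} = {..x}" by auto
        then show ?thesis
          using True y by (simp add: M1 M2_def emeasure_density_dens K_def emeasure_err_atMost atom_side)
      next
        case False
        then have "emeasure M1 {..x} = emeasure K {..x} - emeasure K {?a}"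
          by (subst M1) (auto intro!: emeasure_Diff simp: K_finite)
        also have "\<dots> = ennreal (std_normal_cdf (Z2 x y)) - ennreal (atom y)"
          using False y unfolding K_def emeasure_err_atom[OF less_imp_le[OF y]]
          by (simp add: emeasure_err_atMost atom_side not_less)
        also have "\<dots> = ennreal (std_normal_cdf (Z2 x y) - atom y)"
          using y by (simp add: ennreal_minus atom_bounds)
        finally show ?thesis
          using False y by (simp add: M2_def emeasure_density_dens not_less)
      qed
      then show "cdf M1 x = cdf M2 x" by (simp add: cdf_def measure_def)
    qed
  qed
  then have "emeasure K (A - {?a}) = (\<integral>\<^sup>+x\<in>A. ennreal (dens y x) \<partial>lborel)"
    by (subst M1[symmetric]) (simp_all add: M2_def emeasure_density)
  moreover have "emeasure K A = emeasure K (A \<inter> {?a}) + emeasure K (A - {?a})"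
    by (subst plus_emeasure) (auto intro!: arg_cong2[where f = emeasure])
  moreover have "emeasure K (A \<inter> {?a}) = ennreal (atom y) * indicator A ?a"
    using emeasure_err_atom[of y] y by (auto simp: indicator_def K_def Int_insert_right)
  ultimately show ?thesis by (simp add: K_def)
qed

end

section \<open>Averaging over the estimated scale\<close>

context thresholded_normal
begin

text \<open>The scaled error as a function of an independent pair of standardised error and scale.\<close>

definition mixture :: "nat \<Rightarrow> real \<Rightarrow> real measure" where
  "mixture m \<eta> = distr (std_normal_distribution \<Otimes>\<^sub>M scaled_chi m) borel (\<lambda>(w, s). err (s * \<eta>) w)"

text \<open>Conditioning on the scale: the law of the pair is a product measure, so its sections are
  weighted by the law of the scale.\<close>

lemma emeasure_mixture:
  assumes [measurable]: "A \<in> sets borel"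
  shows "emeasure (mixture m \<eta>) A
    = (\<integral>\<^sup>+s. emeasure (distr std_normal_distribution borel (err (s * \<eta>))) A \<partial>scaled_chi m)"
proof -
  have P: "pair_sigma_finite std_normal_distribution (scaled_chi m)"
    by (intro pair_sigma_finite.intro std_normal.sigma_finite_measure_axioms
        scaled_chi.sigma_finite_measure_axioms)
  have sp: "space (std_normal_distribution \<Otimes>\<^sub>M scaled_chi m) = UNIV"
    using sets_eq_imp_space_eq[OF sets_scaled_chi[of m]] by (simp add: space_pair_measure)
  have "emeasure (mixture m \<eta>) A = emeasure (std_normal_distribution \<Otimes>\<^sub>M scaled_chi m)
      ((\<lambda>(w, s). err (s * \<eta>) w) -` A \<inter> space (std_normal_distribution \<Otimes>\<^sub>M scaled_chi m))"
    unfolding mixture_def by (rule emeasure_distr) measurable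
  also have "\<dots> = (\<integral>\<^sup>+s. emeasure std_normal_distribution
      ((\<lambda>w. (w, s)) -` ((\<lambda>(w, s). err (s * \<eta>) w) -` A \<inter> space (std_normal_distribution \<Otimes>\<^sub>M scaled_chi m)))
        \<partial>scaled_chi m)"
    by (rule pair_sigma_finite.emeasure_pair_measure_alt2[OF P]) measurable
  also have "\<dots> = (\<integral>\<^sup>+s. emeasure (distr std_normal_distribution borel (err (s * \<eta>))) A \<partial>scaled_chi m)"
    by (intro nn_integral_cong, subst emeasure_distr)
      (auto simp: sp intro!: arg_cong2[where f = emeasure])
  finally show ?thesis .
qed

lemma borel_measurable_std_normal_cdf [measurable]: "std_normal_cdf \<in> borel_measurable borel"
  by (intro borel_measurable_continuous_onI continuous_at_imp_continuous_on ballI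
      DERIV_isCont[OF DERIV_std_normal_cdf])

lemma std_normal_density_le_1: "std_normal_density x \<le> 1"
proof -
  have "sqrt (2 * pi) \<ge> 1" using pi_ge_two by simp
  moreover have "exp (- x\<^sup>2 / 2) \<le> 1" by simp
  ultimately have "1 / sqrt (2 * pi) * exp (- x\<^sup>2 / 2) \<le> 1 * 1"
    by (intro mult_mono) auto
  then show ?thesis by (simp add: std_normal_density_def)
qed

text \<open>The normal cdf at the relevant \<open>z\<close> is the conditional cdf given the scale; it remains to
  average it.\<close>

lemma cdf_mixture:
  assumes \<eta>: "\<eta> > 0" and k: "k < n"
  shows "cdf (mixture (n - k) \<eta>) x = H_cdf n k \<xi> \<alpha> \<eta> b \<sigma> x"
proof -
  have m: "n - k \<ge> 1" using k by simp
  define F where "F = (\<lambda>s. std_normal_cdf (if x / \<alpha> + b / \<sigma> \<ge> 0 then Z2 x (s * \<eta>) else Z1 x (s * \<eta>)))"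
  have [measurable]: "F \<in> borel_measurable borel" unfolding F_def by measurable
  have F: "0 \<le> F s" "F s \<le> 1" for s
    by (simp_all add: F_def std_normal.cdf_nonneg std_normal.cdf_bounded_prob)
  have "emeasure (mixture (n - k) \<eta>) {..x} = (\<integral>\<^sup>+s. ennreal (F s) \<partial>scaled_chi (n - k))"
    using AE_scaled_chi_pos[OF m] \<eta> unfolding F_def
    by (subst emeasure_mixture) (auto intro!: nn_integral_cong_AE elim!: eventually_mono
        simp del: if_image_distrib simp: emeasure_err_atMost)
  also have "\<dots> = ennreal (LBINT s:{0<..}. F s * rho (n - k) s)"
    by (rule integral_rho_bounded[OF m, where B = 1]) (auto simp: F)
  finally have "cdf (mixture (n - k) \<eta>) x = (LBINT s:{0<..}. F s * rho (n - k) s)"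
    using F by (simp add: cdf_def measure_def set_lebesgue_integral_def integral_nonneg_AE)
  then show ?thesis by (simp add: F_def H_cdf_def)
qed

lemma nn_integral_dens_mixture:
  assumes \<eta>: "\<eta> > 0" and k: "k < n"
  shows "(\<integral>\<^sup>+s. ennreal (dens (s * \<eta>) x) \<partial>scaled_chi (n - k)) = ennreal (H_density n k \<xi> \<alpha> \<eta> b \<sigma> x)"
proof -
  have m: "n - k \<ge> 1" using k by simp
  let ?c = "1/2 * sqrt n / (\<alpha> * \<xi>)"
  have c: "?c \<ge> 0" using \<alpha> \<xi> by simp
  have scale: "(\<integral>\<^sup>+s. ennreal (?c * (std_normal_density (z s) * r s)) \<partial>scaled_chi (n - k))
      = ennreal (?c * (LBINT s:{0<..}. std_normal_density (z s) * r s * rho (n - k) s))"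
    if [measurable]: "z \<in> borel_measurable borel" "r \<in> borel_measurable borel"
      and r: "\<And>s. 0 \<le> r s" "\<And>s. r s \<le> 2" for z r
  proof -
    have "(\<integral>\<^sup>+s. ennreal (?c * (std_normal_density (z s) * r s)) \<partial>scaled_chi (n - k))
        = ennreal ?c * (\<integral>\<^sup>+s. ennreal (std_normal_density (z s) * r s) \<partial>scaled_chi (n - k))"
      unfolding ennreal_mult'[OF c] by (rule nn_integral_cmult) measurable
    also have "(\<integral>\<^sup>+s. ennreal (std_normal_density (z s) * r s) \<partial>scaled_chi (n - k))
        = ennreal (LBINT s:{0<..}. std_normal_density (z s) * r s * rho (n - k) s)"
    proof (rule integral_rho_bounded[OF m])
      show "std_normal_density (z s) * r s \<le> 1 * 2" for s
        using r std_normal_density_le_1 by (intro mult_mono) auto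
    qed (auto simp: r)
    finally show ?thesis unfolding ennreal_mult'[OF c] .
  qed
  have tb: "0 \<le> 1 + t x y" "1 + t x y \<le> 2" "0 \<le> 1 - t x y" "1 - t x y \<le> 2" for y
    using t_bounds[of x y] by linarith+
  consider "x < - \<alpha> * b / \<sigma>" | "x > - \<alpha> * b / \<sigma>" | "x = - \<alpha> * b / \<sigma>" by linarith
  then show ?thesis
  proof cases
    case 1
    then have "\<not> x > - \<alpha> * b / \<sigma>" by simp
    with 1 show ?thesis
      unfolding H_density_def atom_side dens_def dens_below_def
      by (simp only: if_True of_bool_def if_False mult_zero_right mult_1_right add_0_left)
        (intro scale tb; measurable)
  next
    case 2
    then have "\<not> x < - \<alpha> * b / \<sigma>" by simp
    with 2 show ?thesis
      unfolding H_density_def atom_side dens_def dens_above_def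
      by (simp only: if_True of_bool_def if_False mult_zero_right mult_1_right add_0_right)
        (intro scale tb; measurable)
  next
    case 3
    then have "\<not> x < - \<alpha> * b / \<sigma>" "\<not> x > - \<alpha> * b / \<sigma>" by simp_all
    then show ?thesis
      unfolding H_density_def atom_side dens_def by (simp only: if_False of_bool_def) simp
  qed
qed

text \<open>Average \<open>emeasure_err\<close> over the scale and exchange the integrals.\<close>

lemma emeasure_mixture_atom_density:
  assumes \<eta>: "\<eta> > 0" and k: "k < n" and [measurable]: "A \<in> sets borel"
  shows "emeasure (mixture (n - k) \<eta>) A
    = ennreal (H_atom n k \<xi> \<eta> b \<sigma>) * emeasure (return borel (- \<alpha> * b / \<sigma>)) A
      + (\<integral>\<^sup>+x\<in>A. ennreal (H_density n k \<xi> \<alpha> \<eta> b \<sigma> x) \<partial>lborel)"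
proof -
  have m: "n - k \<ge> 1" using k by simp
  have P: "pair_sigma_finite (scaled_chi (n - k)) (lborel :: real measure)"
    by (intro pair_sigma_finite.intro scaled_chi.sigma_finite_measure_axioms sigma_finite_lborel)
  have [measurable]: "atom \<in> borel_measurable borel" unfolding atom_def[abs_def] by measurable
  have "emeasure (mixture (n - k) \<eta>) A
    = (\<integral>\<^sup>+s. (ennreal (atom (s * \<eta>)) * indicator A (- \<alpha> * b / \<sigma>)
        + (\<integral>\<^sup>+x\<in>A. ennreal (dens (s * \<eta>) x) \<partial>lborel)) \<partial>scaled_chi (n - k))"
    using AE_scaled_chi_pos[OF m] \<eta>
    by (subst emeasure_mixture) (auto intro!: nn_integral_cong_AE elim!: eventually_mono
        simp only: emeasure_err mult_pos_pos assms(3))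
  also have "\<dots> = (\<integral>\<^sup>+s. ennreal (atom (s * \<eta>)) \<partial>scaled_chi (n - k)) * indicator A (- \<alpha> * b / \<sigma>)
      + (\<integral>\<^sup>+s. (\<integral>\<^sup>+x\<in>A. ennreal (dens (s * \<eta>) x) \<partial>lborel) \<partial>scaled_chi (n - k))"
    by (subst nn_integral_add) (auto simp: nn_integral_multc)
  also have "(\<integral>\<^sup>+s. ennreal (atom (s * \<eta>)) \<partial>scaled_chi (n - k)) = ennreal (H_atom n k \<xi> \<eta> b \<sigma>)"
    unfolding H_atom_def atom_def[symmetric]
    by (rule integral_rho_bounded[OF m, where B = 1]) (use \<eta> in \<open>auto intro: atom_bounds\<close>)
  also have "(\<integral>\<^sup>+s. (\<integral>\<^sup>+x\<in>A. ennreal (dens (s * \<eta>) x) \<partial>lborel) \<partial>scaled_chi (n - k))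
      = (\<integral>\<^sup>+x. (\<integral>\<^sup>+s. ennreal (dens (s * \<eta>) x) * indicator A x \<partial>scaled_chi (n - k)) \<partial>lborel)"
    by (rule pair_sigma_finite.Fubini'[OF P, symmetric]) measurable
  also have "\<dots> = (\<integral>\<^sup>+x\<in>A. ennreal (H_density n k \<xi> \<alpha> \<eta> b \<sigma> x) \<partial>lborel)"
    by (simp add: nn_integral_multc nn_integral_dens_mixture[OF \<eta> k])
  finally show ?thesis by simp
qed

end

section \<open>The distribution of the adaptive soft-thresholding estimator\<close>

theorem proposition25:
  fixes X :: "real^'k^'n" and \<theta> :: "real^'k" and \<sigma> \<eta> \<alpha> :: real and i :: 'k
    and M :: "'w measure" and u Y :: "'w \<Rightarrow> real^'n" and law :: "real measure"
  assumes "CARD('k) < CARD('n)" and "rank X = CARD('k)"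
    and "\<sigma> > 0" and "\<eta> > 0" and "\<alpha> > 0"
    and "prob_space M"
    and "prob_space.indep_vars M (\<lambda>_. borel) (\<lambda>j \<omega>. u \<omega> $ j) (UNIV :: 'n set)"
    and "\<And>j. distributed M lborel (\<lambda>\<omega>. u \<omega> $ j) (normal_density 0 \<sigma>)"
    and "\<And>\<omega>. Y \<omega> = X *v \<theta> + u \<omega>"
    and "law = distr M borel (\<lambda>\<omega>. inverse \<sigma> * \<alpha> * (adaptive_soft X \<eta> i (Y \<omega>) - \<theta> $ i))"
  shows "(\<forall>x. cdf law x = H_cdf CARD('n) CARD('k) (xi X i) \<alpha> \<eta> (\<theta> $ i) \<sigma> x)
    \<and> (\<forall>A\<in>sets borel. emeasure law A =
          ennreal (H_atom CARD('n) CARD('k) (xi X i) \<eta> (\<theta> $ i) \<sigma>)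
            * emeasure (return borel (- \<alpha> * \<theta> $ i / \<sigma>)) A
          + (\<integral>\<^sup>+x\<in>A. ennreal (H_density CARD('n) CARD('k) (xi X i) \<alpha> \<eta> (\<theta> $ i) \<sigma> x) \<partial>lborel))"
proof -
  obtain c B where ls: "\<And>\<theta> y. ls_estimator X (X *v \<theta> + y) $ i = \<theta> $ i + c \<bullet> y"
    and c0: "c \<noteq> 0" and xi: "xi X i = sqrt (real CARD('n)) * norm c"
    and B: "finite B" "card B + CARD('k) = CARD('n)" "pairwise orthogonal B" "\<And>b. b \<in> B \<Longrightarrow> norm b = 1"
      "\<And>b. b \<in> B \<Longrightarrow> orthogonal c b"
    and sig: "\<And>\<theta> y. sigma_hat X (X *v \<theta> + y)
        = sqrt (\<Sum>b\<in>B. (b \<bullet> y)\<^sup>2) / sqrt (real CARD('n) - real CARD('k))"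
    using regression_geometry[OF assms(2), of i] by metis
  have card: "card B = CARD('n) - CARD('k)" "real CARD('n) - real CARD('k) = real (card B)"
    using B(2) by linarith+
  interpret T: thresholded_normal "CARD('n)" "xi X i" \<alpha> "\<theta> $ i" \<sigma>
    by unfold_locales (use assms c0 xi in auto)
  define a where "a = c /\<^sub>R norm c"
  define g where "g = (\<lambda>z. (a \<bullet> z, sqrt (\<Sum>b\<in>B. (b \<bullet> z)\<^sup>2) / sqrt (real (card B))))"
  have [measurable]: "g \<in> borel \<rightarrow>\<^sub>M borel \<Otimes>\<^sub>M borel"
    unfolding g_def by measurable
  have u_meas: "(\<lambda>\<omega>. u \<omega> $ j) \<in> borel_measurable M" for j
    using distributed_measurable[OF assms(8)[of j]] by simp
  have [measurable]: "(\<lambda>\<omega>. u \<omega> /\<^sub>R \<sigma>) \<in> borel_measurable M"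
    by (intro borel_measurable_scaleR borel_measurable_const)
      (use borel_measurable_vec_lambda[of "\<lambda>\<omega> j. u \<omega> $ j", OF u_meas] in simp)
  have "distr M (borel \<Otimes>\<^sub>M borel) (\<lambda>\<omega>. g (u \<omega> /\<^sub>R \<sigma>)) = distr (distr M borel (\<lambda>\<omega>. u \<omega> /\<^sub>R \<sigma>)) (borel \<Otimes>\<^sub>M borel) g"
    by (subst distr_distr) (auto simp: comp_def)
  also have "\<dots> = distr std_gaussian (borel \<Otimes>\<^sub>M borel) g"
    by (simp only: prob_space.std_gaussian_scaled_noise[OF assms(6,3,7,8)])
  also have "\<dots> = std_normal_distribution \<Otimes>\<^sub>M scaled_chi (card B)"
    unfolding g_def using c0 B
    by (intro joint_law_std_gaussian) (auto simp: a_def orthogonal_def)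
  finally have joint: "distr M (borel \<Otimes>\<^sub>M borel) (\<lambda>\<omega>. g (u \<omega> /\<^sub>R \<sigma>))
    = std_normal_distribution \<Otimes>\<^sub>M scaled_chi (card B)" .
  \<comment> \<open>The factor \<open>\<sigma>\<close> common to the estimate and to \<open>sigma_hat\<close> is pulled out of the thresholding.\<close>
  have repr: "inverse \<sigma> * \<alpha> * (adaptive_soft X \<eta> i (Y \<omega>) - \<theta> $ i)
      = (case g (u \<omega> /\<^sub>R \<sigma>) of (w, s) \<Rightarrow> T.err (s * \<eta>) w)" for \<omega>
  proof -
    define w where "w = a \<bullet> (u \<omega> /\<^sub>R \<sigma>)"
    define s where "s = sqrt (\<Sum>b\<in>B. (b \<bullet> (u \<omega> /\<^sub>R \<sigma>))\<^sup>2) / sqrt (real (card B))"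
    have "(\<Sum>b\<in>B. (b \<bullet> u \<omega>)\<^sup>2) = \<sigma>\<^sup>2 * (\<Sum>b\<in>B. (b \<bullet> (u \<omega> /\<^sub>R \<sigma>))\<^sup>2)"
      unfolding sum_distrib_left using assms(3)
      by (intro sum.cong refl) (simp add: field_simps)
    then have s: "sigma_hat X (Y \<omega>) = \<sigma> * s"
      using assms(3) by (simp add: assms(9) sig card(2) s_def real_sqrt_mult)
    have w: "ls_estimator X (Y \<omega>) $ i = \<sigma> * (\<theta> $ i / \<sigma> + xi X i / sqrt (real CARD('n)) * w)"
      unfolding assms(9) ls using assms(3) c0 by (simp add: w_def a_def xi field_simps)
    have s0: "s \<ge> 0" by (simp add: s_def sum_nonneg)
    have "adaptive_soft X \<eta> i (Y \<omega>) = soft (sigma_hat X (Y \<omega>) * xi X i * \<eta>) (ls_estimator X (Y \<omega>) $ i)"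
      unfolding soft_def using assms(3,4) s0 T.\<xi>
      by (intro adaptive_soft_cases) (auto simp: s)
    also have "\<dots> = soft (\<sigma> * (xi X i * (s * \<eta>))) (\<sigma> * (\<theta> $ i / \<sigma> + xi X i / sqrt (real CARD('n)) * w))"
      unfolding s w by (simp add: ac_simps)
    also have "\<dots> = \<sigma> * soft (xi X i * (s * \<eta>)) (\<theta> $ i / \<sigma> + xi X i / sqrt (real CARD('n)) * w)"
      by (rule soft_scale[OF assms(3)])
    finally have "inverse \<sigma> * \<alpha> * (adaptive_soft X \<eta> i (Y \<omega>) - \<theta> $ i) = T.err (s * \<eta>) w"
      unfolding T.err_def using assms(3) by (simp add: field_simps)
    then show ?thesis by (simp add: g_def w_def s_def)
  qed
  have "law = distr (distr M (borel \<Otimes>\<^sub>M borel) (\<lambda>\<omega>. g (u \<omega> /\<^sub>R \<sigma>))) borel (\<lambda>(w, s). T.err (s * \<eta>) w)"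
    unfolding assms(10) repr by (subst distr_distr) (auto simp: comp_def)
  then have "law = T.mixture (CARD('n) - CARD('k)) \<eta>"
    unfolding joint T.mixture_def card(1) .
  then show ?thesis
    using T.cdf_mixture[OF assms(4,1)] T.emeasure_mixture_atom_density[OF assms(4,1)] by simp
qed

end
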